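(* Consider the $L$-cell distributed antenna array massive MIMO system with $K$ users and $N$ sub-arrays of $M$ antennas per cell described in the context. Assume that the base stations use maximum ratio transmission based on the MMSE channel estimates, i.e. $\mathbf{a}_{jk}^{n}=\widehat{\mathbf{h}}_{jk}^{jn}=\mathbf{W}_{jk}^n\mathbf{y}_{jk}^{jn}$ for all $j\in\{1,\dots,L\}$, $k\in\{1,\dots,K\}$, $n\in\{1,\dots,N\}$, where $\mathbf{W}_{jk}^{n}=\mathbf{R}_{jk}^{jn}(\mathbf{Q}_{jk}^{n})^{-1}$. Then, for all power control coefficients $\nu_{li}^n\ge 0$ and every user $(j,k)$, the effective downlink SINR $$\gamma_{jk}=\frac{\left|\sum_{n=1}^N \nu_{jk}^n\,\mathbb{E}\left[(\mathbf{h}_{jk}^{jn})^{\mathrm H}\mathbf{a}_{jk}^{n}\right]\right|^2}{\sum_{l=1}^L\sum_{i=1}^K\mathbb{E}\left[\left|\sum_{n=1}^N\nu_{li}^n(\mathbf{h}_{jk}^{ln})^{\mathrm H}\mathbf{a}_{li}^{n}\right|^2\right]-\left|\sum_{n=1}^N\nu_{jk}^n\,\mathbb{E}\left[(\mathbf{h}_{jk}^{jn})^{\mathrm H}\mathbf{a}_{jk}^{n}\right]\right|^2+\sigma_n^2}$$ is equal to $$\gamma_{jk}^{\mathrm{MMSE}}=\frac{\left|\sum_{n=1}^N\mathrm{tr}\left(\nu_{jk}^n\mathbf{W}_{jk}^{n}\mathbf{R}_{jk}^{jn}\right)\right|^2}{\sum_{l=1}^L\sum_{i=1}^K\sum_{n=1}^N\mathrm{tr}\left((\nu_{li}^n)^2\mathbf{W}_{li}^n\mathbf{Q}_{li}^n(\mathbf{W}_{li}^n)^{\mathrm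 H}\mathbf{R}_{jk}^{ln}\right)+\sum_{l=1,\,l\neq j}^L\left|\sum_{n=1}^N\mathrm{tr}\left(\nu_{lk}^n\mathbf{W}_{lk}^n\mathbf{R}_{jk}^{ln}\right)\right|^2+\sigma_n^2}.$$
   Context: Let $L,K,N,M\ge 1$ be integers, $\rho_{\mathrm{tr}}>0$ and $\sigma_n^2>0$ (here $\sigma_n^2$ is a fixed noise variance; its subscript is not the summation index $n$). There are $L$ cells, each with $K$ single-antenna users and $N$ sub-arrays of $M$ antennas. User $k$ of cell $j$ is denoted $(j,k)$. Channels: $\mathbf{h}_{jk}^{ln}\in\mathbb{C}^M$ is the channel between user $(j,k)$ and sub-array $n$ of cell $l$; $\mathbf{h}_{jk}^{ln}\sim\mathcal{CN}(\mathbf{0},\mathbf{R}_{jk}^{ln})$ (circularly symmetric complex Gaussian), with $\mathbf{R}_{jk}^{ln}$ an $M\times M$ Hermitian positive semidefinite covariance matrix. All the channel vectors, over all $(j,k,l,n)$, are mutually independent. Pilots: user $(j,k)$ has a pilot $\boldsymbol{\phi}_{jk}\in\mathbb{C}^{K}$ with $\|\boldsymbol{\phi}_{jk}\|=1$. Pilots within a cell are orthogonal and the same pilots are reused in every cell, with user index $k$ using the same pilot in every cell; thus $\rho_{li}^{jk}:=\boldsymbol{\phi}_{li}^{\mathrm H}\boldsymbol{\phi}_{jk}$ equals $1$ if $i=k$ and $0$ if $i\ne k$. Pilot observation: sub-array $n$ of cell $j$ forms $$\mathbf{y}_{jk}^{jn}=\Big(\sum_{l=1}^L\sum_{i=1}^K\mathbf{h}_{li}^{jn}\boldsymbol{\phi}_{li}^{\mathrm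 H}+\tfrac{1}{\sqrt{\rho_{\mathrm{tr}}}}\mathbf{N}_j^n\Big)\boldsymbol{\phi}_{jk},$$ where the noise matrices $\mathbf{N}_j^n\in\mathbb{C}^{M\times K}$ have i.i.d. $\mathcal{CN}(0,1)$ entries, are independent over $(j,n)$, and are independent of all channels. Its covariance is $$\mathbf{Q}_{jk}^n=\mathbb{E}\left[\mathbf{y}_{jk}^{jn}(\mathbf{y}_{jk}^{jn})^{\mathrm H}\right]=\sum_{l=1}^L\sum_{i=1}^K|\rho_{li}^{jk}|^2\mathbf{R}_{li}^{jn}+\tfrac{1}{\rho_{\mathrm{tr}}}\mathbf{I}_M.$$ Downlink: $\mathbf{a}_{li}^n\in\mathbb{C}^M$ is the precoding vector used for user $(l,i)$ at sub-array $n$ of cell $l$, and $\nu_{li}^n\ge0$ is the corresponding deterministic real power control coefficient. $(\cdot)^{\mathrm H}$ denotes the Hermitian transpose. *)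

theory Defs
  imports "HOL-Probability.Probability"
begin

section \<open>Complex vectors and matrices\<close>

definition cdot :: "complex ^ 'm \<Rightarrow> complex ^ 'm \<Rightarrow> complex"
  where "cdot x y = (\<Sum>i\<in>UNIV. cnj (x $ i) * y $ i)"

definition conj_transpose :: "complex ^ 'n ^ 'm \<Rightarrow> complex ^ 'm ^ 'n"
  where "conj_transpose A = (\<chi> i j. cnj (A $ j $ i))"

definition outer :: "complex ^ 'm \<Rightarrow> complex ^ 'n \<Rightarrow> complex ^ 'n ^ 'm"
  where "outer x y = (\<chi> i j. x $ i * cnj (y $ j))"

definition cnj_vec :: "complex ^ 'm \<Rightarrow> complex ^ 'm"
  where "cnj_vec x = (\<chi> i. cnj (x $ i))"

definition hermitian_psd :: "complex ^ 'm ^ 'm \<Rightarrow> bool"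
  where "hermitian_psd A \<longleftrightarrow>
    conj_transpose A = A \<and> (\<forall>x. cdot x (A *v x) \<in> \<real> \<and> 0 \<le> Re (cdot x (A *v x)))"


section \<open>Circularly symmetric complex Gaussian vectors\<close>

text \<open>Covariance matrices may be singular, so the degenerate (almost surely constant)
  normal distribution has to be admitted.\<close>

definition gaussian_rv :: "'w measure \<Rightarrow> ('w \<Rightarrow> real) \<Rightarrow> bool"
  where "gaussian_rv P X \<longleftrightarrow> X \<in> borel_measurable P \<and>
    (\<exists>\<mu> \<sigma>. (\<sigma> = 0 \<and> (AE \<omega> in P. X \<omega> = \<mu>)) \<or>
           (\<sigma> > 0 \<and> distributed P lborel X (normal_density \<mu> \<sigma>)))"

text \<open>On \<open>complex ^ 'm\<close> the operation \<open>\<bullet>\<close> is the \<^emph>\<open>real\<close> inner product, so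
  \<open>c \<bullet> Z\<close> ranges over all real linear combinations of the real and imaginary parts of the
  components of \<open>Z\<close>: the condition is joint normality of the real and imaginary parts.\<close>

definition complex_gaussian_vector :: "'w measure \<Rightarrow> ('w \<Rightarrow> complex ^ 'm) \<Rightarrow> bool"
  where "complex_gaussian_vector P Z \<longleftrightarrow>
    Z \<in> borel_measurable P \<and> (\<forall>c. gaussian_rv P (\<lambda>\<omega>. c \<bullet> Z \<omega>))"

text \<open>\<open>Z \<sim> CN(0, R)\<close>: jointly Gaussian with zero mean, covariance \<open>E[Z Z\<^sup>H] = R\<close>, and
  vanishing pseudo-covariance \<open>E[Z Z\<^sup>T] = 0\<close> (circular symmetry).\<close>

definition circ_complex_gaussian ::
    "'w measure \<Rightarrow> ('w \<Rightarrow> complex ^ 'm) \<Rightarrow> complex ^ 'm ^ 'm \<Rightarrow> bool"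
  where "circ_complex_gaussian P Z R \<longleftrightarrow>
    complex_gaussian_vector P Z \<and>
    (\<integral>\<omega>. Z \<omega> \<partial>P) = 0 \<and>
    (\<integral>\<omega>. outer (Z \<omega>) (Z \<omega>) \<partial>P) = R \<and>
    (\<integral>\<omega>. outer (Z \<omega>) (cnj_vec (Z \<omega>)) \<partial>P) = 0"


section \<open>Independence of two random variables of different types\<close>

text \<open>The library's \<open>prob_space.indep_var\<close> requires both variables to have the same
  value type.\<close>

definition indep_rvs ::
    "'w measure \<Rightarrow> 'b measure \<Rightarrow> ('w \<Rightarrow> 'b) \<Rightarrow> 'c measure \<Rightarrow> ('w \<Rightarrow> 'c) \<Rightarrow> bool"
  where "indep_rvs P S X T Y \<longleftrightarrow> X \<in> measurable P S \<and> Y \<in> measurable P T \<and>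
    prob_space.indep_set P {X -` A \<inter> space P | A. A \<in> sets S} {Y -` B \<inter> space P | B. B \<in> sets T}"


section \<open>The multi-cell system\<close>

text \<open>The index types \<open>'l\<close>, \<open>'k\<close>, \<open>'n\<close>, \<open>'m\<close> enumerate cells, users per cell, sub-arrays per
  cell, and antennas per sub-array.  The channel from user \<open>(j,k)\<close> to sub-array \<open>n\<close> of
  cell \<open>l\<close> is \<open>h j k l n\<close>; the noise matrix at sub-array \<open>n\<close> of cell \<open>j\<close> is \<open>Nz j n\<close>.
  Channels and noise are functions of the sample point.\<close>

definition pilot_observation ::
    "real \<Rightarrow> ('l \<Rightarrow> 'k \<Rightarrow> complex ^ 'k) \<Rightarrow>
     ('l \<Rightarrow> 'k \<Rightarrow> 'l \<Rightarrow> 'n \<Rightarrow> 'w \<Rightarrow> complex ^ 'm) \<Rightarrow>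
     ('l \<Rightarrow> 'n \<Rightarrow> 'w \<Rightarrow> complex ^ 'k ^ 'm) \<Rightarrow>
     'l::finite \<Rightarrow> 'k::finite \<Rightarrow> 'n \<Rightarrow> 'w \<Rightarrow> complex ^ 'm"
  where "pilot_observation \<rho> \<phi> h Nz j k n \<omega> =
    ((\<Sum>l\<in>UNIV. \<Sum>i\<in>UNIV. outer (h l i j n \<omega>) (\<phi> l i)) + (1 / sqrt \<rho>) *\<^sub>R Nz j n \<omega>) *v \<phi> j k"

definition downlink_sinr ::
    "'w measure \<Rightarrow> real \<Rightarrow> ('l \<Rightarrow> 'k \<Rightarrow> 'n \<Rightarrow> real) \<Rightarrow>
     ('l \<Rightarrow> 'k \<Rightarrow> 'l \<Rightarrow> 'n \<Rightarrow> 'w \<Rightarrow> complex ^ 'm) \<Rightarrow>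
     ('l \<Rightarrow> 'k \<Rightarrow> 'n \<Rightarrow> 'w \<Rightarrow> complex ^ 'm) \<Rightarrow>
     'l::finite \<Rightarrow> 'k::finite \<Rightarrow> real"
  where "downlink_sinr P \<sigma>2 \<nu> h a j k =
    (cmod (\<Sum>n\<in>UNIV. of_real (\<nu> j k n) * (\<integral>\<omega>. cdot (h j k j n \<omega>) (a j k n \<omega>) \<partial>P)))\<^sup>2 /
    ((\<Sum>l\<in>UNIV. \<Sum>i\<in>UNIV.
        (\<integral>\<omega>. (cmod (\<Sum>n\<in>UNIV. of_real (\<nu> l i n) * cdot (h j k l n \<omega>) (a l i n \<omega>)))\<^sup>2 \<partial>P))
     - (cmod (\<Sum>n\<in>UNIV. of_real (\<nu> j k n) * (\<integral>\<omega>. cdot (h j k j n \<omega>) (a j k n \<omega>) \<partial>P)))\<^sup>2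
     + \<sigma>2)"

end

theory Submission
  imports Defs
begin

text \<open>For a fixed interfering user \<open>(l, i)\<close>, orthogonality and reuse of the pilots give
  \<open>y = d H + z\<close>, where \<open>H\<close> is the channel from user \<open>(j, k)\<close> to the same sub-array, \<open>z\<close> is
  centred and independent of \<open>H\<close>, and \<open>d\<close> is \<open>1\<close> if \<open>i = k\<close> (pilot contamination) and
  \<open>0\<close> otherwise.  The Isserlis formula for the fourth moments of \<open>H\<close> shows that \<open>H\<^sup>H W y\<close> has mean
  \<open>d tr(W R)\<close> and variance \<open>tr(W Q W\<^sup>H R)\<close>, where \<open>Q = E[y y\<^sup>H]\<close>; this holds for every
  deterministic \<open>W\<close>.  These variables are independent over the sub-arrays, so the interference power
  is the squared modulus of the mean of their weighted sum plus the sum of the weighted variances.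
  For \<open>i = k\<close> the squared mean belonging to cell \<open>l = j\<close> is the signal power, which cancels in
  the denominator.\<close>

section \<open>Square-integrable random variables\<close>

lemma measurable_cnj [measurable]: "cnj \<in> borel_measurable borel"
  by (intro borel_measurable_continuous_onI continuous_intros)

text \<open>The space L^2 with measurability built in, over a normed field so that it serves real
  and complex variables alike. Integrability obligations below are mostly settled by writing the
  integrand as a product of two members.\<close>

definition sq_integrable ::
    "'w measure \<Rightarrow> ('w \<Rightarrow> 'a::{real_normed_field, banach, second_countable_topology}) \<Rightarrow> bool"
  where "sq_integrable M f \<longleftrightarrow> f \<in> borel_measurable M \<and> integrable M (\<lambda>\<omega>. (norm (f \<omega>))\<^sup>2)"

lemma sq_integrable_mult_integrable:
  assumes "sq_integrable M f" "sq_integrable M g"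
  shows "integrable M (\<lambda>\<omega>. f \<omega> * g \<omega>)"
proof (rule Bochner_Integration.integrable_bound)
  show "integrable M (\<lambda>\<omega>. (norm (f \<omega>))\<^sup>2 + (norm (g \<omega>))\<^sup>2)"
    using assms by (auto simp: sq_integrable_def)
  show "(\<lambda>\<omega>. f \<omega> * g \<omega>) \<in> borel_measurable M"
    using assms by (auto simp: sq_integrable_def)
  have "norm (f \<omega> * g \<omega>) \<le> (norm (f \<omega>))\<^sup>2 + (norm (g \<omega>))\<^sup>2" for \<omega>
    using sum_squares_bound[of "norm (f \<omega>)" "norm (g \<omega>)"] norm_ge_zero[of "f \<omega> * g \<omega>"]
    unfolding norm_mult by linarith
  then show "AE \<omega> in M. norm (f \<omega> * g \<omega>) \<le> norm ((norm (f \<omega>))\<^sup>2 + (norm (g \<omega>))\<^sup>2)"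
    by simp
qed

lemma sq_integrable_add:
  assumes "sq_integrable M f" "sq_integrable M g"
  shows "sq_integrable M (\<lambda>\<omega>. f \<omega> + g \<omega>)"
  unfolding sq_integrable_def
proof
  show m: "(\<lambda>\<omega>. f \<omega> + g \<omega>) \<in> borel_measurable M"
    using assms by (auto simp: sq_integrable_def)
  show "integrable M (\<lambda>\<omega>. (norm (f \<omega> + g \<omega>))\<^sup>2)"
  proof (rule Bochner_Integration.integrable_bound)
    show "integrable M (\<lambda>\<omega>. 2 * (norm (f \<omega>))\<^sup>2 + 2 * (norm (g \<omega>))\<^sup>2)"
      using assms by (auto simp: sq_integrable_def)
    have "(norm (f \<omega> + g \<omega>))\<^sup>2 \<le> 2 * (norm (f \<omega>))\<^sup>2 + 2 * (norm (g \<omega>))\<^sup>2" for \<omega>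
    proof -
      have "(norm (f \<omega> + g \<omega>))\<^sup>2 \<le> (norm (f \<omega>) + norm (g \<omega>))\<^sup>2"
        by (intro power_mono norm_triangle_ineq) simp
      then show ?thesis
        using sum_squares_bound[of "norm (f \<omega>)" "norm (g \<omega>)"] by (simp add: power2_sum)
    qed
    then show "AE \<omega> in M. norm ((norm (f \<omega> + g \<omega>))\<^sup>2) \<le> norm (2 * (norm (f \<omega>))\<^sup>2 + 2 * (norm (g \<omega>))\<^sup>2)"
      by simp
  qed (use m in measurable)
qed

lemma sq_integrable_cmult:
  "sq_integrable M f \<Longrightarrow> sq_integrable M (\<lambda>\<omega>. c * f \<omega>)"
  by (auto simp: sq_integrable_def norm_mult power_mult_distrib)

lemma sq_integrable_zero [simp]: "sq_integrable M (\<lambda>_. 0)"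
  by (simp add: sq_integrable_def)

lemma sq_integrable_sum:
  "(\<And>i. i \<in> I \<Longrightarrow> sq_integrable M (f i)) \<Longrightarrow> sq_integrable M (\<lambda>\<omega>. \<Sum>i\<in>I. f i \<omega>)"
  by (induction I rule: infinite_finite_induct) (auto intro: sq_integrable_add)

lemma sq_integrable_cnj: "sq_integrable M f \<Longrightarrow> sq_integrable M (\<lambda>\<omega>. cnj (f \<omega>))"
  by (auto simp: sq_integrable_def intro: measurable_compose[OF _ measurable_cnj])

lemma sq_integrable_of_real:
  fixes f :: "'w \<Rightarrow> real"
  shows "sq_integrable M f \<Longrightarrow> sq_integrable M (\<lambda>\<omega>. complex_of_real (f \<omega>))"
  by (auto simp: sq_integrable_def)

text \<open>The hypotheses are finite fourth moments, and 2 |f g|^2 <= |f|^4 + |g|^4. Measurability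
  is listed separately because that of \<open>f * f\<close> does not give that of
  \<open>f\<close>.\<close>

lemma sq_integrable_mult:
  assumes "sq_integrable M (\<lambda>\<omega>. f \<omega> * f \<omega>)" "sq_integrable M (\<lambda>\<omega>. g \<omega> * g \<omega>)"
    and m: "f \<in> borel_measurable M" "g \<in> borel_measurable M"
  shows "sq_integrable M (\<lambda>\<omega>. f \<omega> * g \<omega>)"
  unfolding sq_integrable_def
proof
  show "(\<lambda>\<omega>. f \<omega> * g \<omega>) \<in> borel_measurable M" using m by measurable
  show "integrable M (\<lambda>\<omega>. (norm (f \<omega> * g \<omega>))\<^sup>2)"
  proof (rule Bochner_Integration.integrable_bound)
    show "integrable M (\<lambda>\<omega>. (norm (f \<omega> * f \<omega>))\<^sup>2 + (norm (g \<omega> * g \<omega>))\<^sup>2)"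
      using assms by (auto simp: sq_integrable_def)
    have "(norm (f \<omega> * g \<omega>))\<^sup>2 \<le> (norm (f \<omega> * f \<omega>))\<^sup>2 + (norm (g \<omega> * g \<omega>))\<^sup>2" for \<omega>
    proof -
      have "2 * (norm (f \<omega> * g \<omega>))\<^sup>2 \<le> (norm (f \<omega> * f \<omega>))\<^sup>2 + (norm (g \<omega> * g \<omega>))\<^sup>2"
        using sum_squares_bound[of "norm (f \<omega> * f \<omega>)" "norm (g \<omega> * g \<omega>)"]
        by (simp add: norm_mult power2_eq_square ac_simps)
      then show ?thesis
        using zero_le_power2[of "norm (f \<omega> * g \<omega>)"] by linarith
    qed
    then show "AE \<omega> in M. norm ((norm (f \<omega> * g \<omega>))\<^sup>2)
        \<le> norm ((norm (f \<omega> * f \<omega>))\<^sup>2 + (norm (g \<omega> * g \<omega>))\<^sup>2)"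
      by simp
  qed (use m in measurable)
qed

context prob_space
begin

lemma sq_integrable_integrable: "sq_integrable M f \<Longrightarrow> integrable M f"
  using sq_integrable_mult_integrable[of M f "\<lambda>_. 1"] by (simp add: sq_integrable_def)

text \<open>Independence factors E[|f|^2 |g|^2], so second moments suffice. This serves products of
  a channel entry with the interference \<open>z\<close>, of which only second moments are
  known.\<close>

lemma sq_integrable_indep_mult:
  fixes f g :: "'a \<Rightarrow> complex"
  assumes ind: "indep_var borel f borel g" and "sq_integrable M f" "sq_integrable M g"
  shows "sq_integrable M (\<lambda>\<omega>. f \<omega> * g \<omega>)"
proof -
  have "indep_var borel ((\<lambda>x. (norm x)\<^sup>2) \<circ> f) borel ((\<lambda>x. (norm x)\<^sup>2) \<circ> g)"
    by (rule indep_var_compose[OF ind]) auto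
  then have "integrable M (\<lambda>\<omega>. ((\<lambda>x. (norm x)\<^sup>2) \<circ> f) \<omega> * ((\<lambda>x. (norm x)\<^sup>2) \<circ> g) \<omega>)"
    by (rule indep_var_integrable) (use assms in \<open>auto simp: sq_integrable_def o_def\<close>)
  then show ?thesis
    using assms by (auto simp: sq_integrable_def norm_mult power_mult_distrib)
qed

section \<open>Fourth moments of Gaussian vectors\<close>

text \<open>A degenerate variable with mean zero vanishes almost surely; a centred normal one has
  fourth moment three times its squared variance. This factor 3 is what the fourth-order product
  formula is later polarized from.\<close>

lemma gaussian_rv_moments:
  assumes "gaussian_rv M X" "expectation X = 0"
  shows "integrable M (\<lambda>\<omega>. X \<omega> ^ 2)" "integrable M (\<lambda>\<omega>. X \<omega> ^ 4)"
    "expectation (\<lambda>\<omega>. X \<omega> ^ 4) = 3 * (expectation (\<lambda>\<omega>. X \<omega> ^ 2))\<^sup>2"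
proof -
  have X [measurable]: "X \<in> borel_measurable M"
    using assms by (simp add: gaussian_rv_def)
  obtain \<mu> \<sigma> where c: "(\<sigma> = 0 \<and> (AE \<omega> in M. X \<omega> = \<mu>)) \<or>
           (\<sigma> > 0 \<and> distributed M lborel X (normal_density \<mu> \<sigma>))"
    using assms by (auto simp: gaussian_rv_def)
  have "integrable M (\<lambda>\<omega>. X \<omega> ^ 2) \<and> integrable M (\<lambda>\<omega>. X \<omega> ^ 4) \<and>
    expectation (\<lambda>\<omega>. X \<omega> ^ 4) = 3 * (expectation (\<lambda>\<omega>. X \<omega> ^ 2))\<^sup>2"
    using c
  proof (elim disjE conjE)
    assume ae: "AE \<omega> in M. X \<omega> = \<mu>"
    have int: "integrable M (\<lambda>\<omega>. X \<omega> ^ p)" "expectation (\<lambda>\<omega>. X \<omega> ^ p) = \<mu> ^ p" for p :: nat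
    proof -
      have *: "AE \<omega> in M. X \<omega> ^ p = \<mu> ^ p" using ae by auto
      show "integrable M (\<lambda>\<omega>. X \<omega> ^ p)"
        by (subst integrable_cong_AE[OF _ _ *]) auto
      show "expectation (\<lambda>\<omega>. X \<omega> ^ p) = \<mu> ^ p"
        by (subst integral_cong_AE[OF _ _ *]) (auto simp: prob_space)
    qed
    have "\<mu> = 0" using int(2)[of 1] assms by simp
    then show ?thesis using int by simp
  next
    assume s: "\<sigma> > 0" and d: "distributed M lborel X (normal_density \<mu> \<sigma>)"
    have nn: "\<And>x. x \<in> space lborel \<Longrightarrow> 0 \<le> normal_density \<mu> \<sigma> x" by simp
    have "expectation X = \<mu>"
      using distributed_integral[OF d _ nn, of "\<lambda>x. x"] integral_normal_moment_nz_1[OF s] by simp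
    then have mu: "\<mu> = 0" using assms by simp
    \<comment> \<open>The even moments of a centred normal density: \<open>p = 1\<close> gives
      sigma^2, and \<open>p = 2\<close> gives 24 / (8 / sigma^4) = 3 sigma^4.\<close>
    have e: "expectation (\<lambda>\<omega>. X \<omega> ^ (2 * p)) = fact (2 * p) / ((2 / \<sigma>\<^sup>2)^p * fact p)" for p
      using distributed_integral[OF d _ nn, of "\<lambda>x. x ^ (2 * p)"]
        integral_normal_moment_even[OF s, of \<mu> p] mu by simp
    have i: "integrable M (\<lambda>\<omega>. X \<omega> ^ p)" for p :: nat
      using distributed_integrable[OF d _ nn, of "\<lambda>x. x ^ p"]
        integrable_normal_moment[OF s, of \<mu> p] mu by simp
    have "expectation (\<lambda>\<omega>. X \<omega> ^ 2) = \<sigma>\<^sup>2" "expectation (\<lambda>\<omega>. X \<omega> ^ 4) = 3 * \<sigma> ^ 4"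
      using e[of 1] e[of 2] s by (simp_all add: fact_numeral power_divide)
    then show ?thesis
      using i by (simp flip: power_mult)
  qed
  then show "integrable M (\<lambda>\<omega>. X \<omega> ^ 2)" "integrable M (\<lambda>\<omega>. X \<omega> ^ 4)"
    "expectation (\<lambda>\<omega>. X \<omega> ^ 4) = 3 * (expectation (\<lambda>\<omega>. X \<omega> ^ 2))\<^sup>2" by auto
qed

end

section \<open>Real linear forms of a centred Gaussian vector\<close>

lemma integrable_euclidean_componentwise:
  fixes Z :: "'w \<Rightarrow> 'a::euclidean_space"
  assumes "\<And>b. b \<in> Basis \<Longrightarrow> integrable M (\<lambda>\<omega>. b \<bullet> Z \<omega>)"
  shows "integrable M Z"
proof -
  have "integrable M (\<lambda>\<omega>. \<Sum>b\<in>Basis. (b \<bullet> Z \<omega>) *\<^sub>R b)"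
    using assms by auto
  then show ?thesis
    by (simp add: inner_commute[of _ "Z _"] euclidean_representation)
qed

locale centered_gaussian = prob_space M for M :: "'w measure" +
  fixes Z :: "'w \<Rightarrow> complex ^ 'm"
  assumes gaussian: "complex_gaussian_vector M Z"
    and centered: "expectation Z = 0"
begin

lemma measurable_Z [measurable]: "Z \<in> borel_measurable M"
  using gaussian by (simp add: complex_gaussian_vector_def)

lemma gaussian_inner: "gaussian_rv M (\<lambda>\<omega>. c \<bullet> Z \<omega>)"
  using gaussian by (simp add: complex_gaussian_vector_def)

text \<open>This must precede \<open>expectation_inner\<close>: taking the inner product out of the
  expectation requires \<open>Z\<close> to be integrable, and \<open>gaussian_rv_moments\<close>
  applies only once the mean of \<open>c \<bullet> Z\<close> is known to be zero.\<close>

lemma integrable_inner: "integrable M (\<lambda>\<omega>. c \<bullet> Z \<omega>)"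
proof -
  have g: "gaussian_rv M (\<lambda>\<omega>. c \<bullet> Z \<omega>)" by (rule gaussian_inner)
  then obtain \<mu> \<sigma> where c: "(\<sigma> = 0 \<and> (AE \<omega> in M. c \<bullet> Z \<omega> = \<mu>)) \<or>
           (\<sigma> > 0 \<and> distributed M lborel (\<lambda>\<omega>. c \<bullet> Z \<omega>) (normal_density \<mu> \<sigma>))"
    unfolding gaussian_rv_def by blast
  then show ?thesis
  proof (elim disjE conjE)
    assume "AE \<omega> in M. c \<bullet> Z \<omega> = \<mu>"
    then show ?thesis
      by (subst integrable_cong_AE[of _ _ "\<lambda>_. \<mu>"]) auto
  next
    assume s: "\<sigma> > 0" and d: "distributed M lborel (\<lambda>\<omega>. c \<bullet> Z \<omega>) (normal_density \<mu> \<sigma>)"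
    show ?thesis
      using distributed_integrable_var[OF d] integrable_normal_moment_nz_1[OF s] by simp
  qed
qed

lemma expectation_inner: "expectation (\<lambda>\<omega>. c \<bullet> Z \<omega>) = 0"
proof -
  have "integrable M Z"
    by (rule integrable_euclidean_componentwise) (rule integrable_inner)
  then have "expectation (\<lambda>\<omega>. c \<bullet> Z \<omega>) = c \<bullet> expectation Z"
    by (intro integral_inner_right)
  then show ?thesis by (simp add: centered)
qed

lemmas inner_moments = gaussian_rv_moments[OF gaussian_inner expectation_inner]

lemma sq_integrable_inner: "sq_integrable M (\<lambda>\<omega>. c \<bullet> Z \<omega>)"
  using inner_moments(1)[of c] by (simp add: sq_integrable_def)

lemma sq_integrable_inner_mult: "sq_integrable M (\<lambda>\<omega>. (c \<bullet> Z \<omega>) * (d \<bullet> Z \<omega>))"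
proof (rule sq_integrable_mult)
  have "sq_integrable M (\<lambda>\<omega>. (e \<bullet> Z \<omega>) * (e \<bullet> Z \<omega>))" for e
    using inner_moments(2)[of e]
    by (simp add: sq_integrable_def power4_eq_xxxx power2_eq_square abs_mult mult.assoc)
  then show "sq_integrable M (\<lambda>\<omega>. (c \<bullet> Z \<omega>) * (c \<bullet> Z \<omega>))"
    "sq_integrable M (\<lambda>\<omega>. (d \<bullet> Z \<omega>) * (d \<bullet> Z \<omega>))" by auto
qed auto

section \<open>The covariance form and the real Isserlis formula\<close>

definition cov :: "complex ^ 'm \<Rightarrow> complex ^ 'm \<Rightarrow> real"
  where "cov c d = expectation (\<lambda>\<omega>. (c \<bullet> Z \<omega>) * (d \<bullet> Z \<omega>))"

lemma cov_commute: "cov c d = cov d c"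
  by (simp add: cov_def mult.commute)

lemma cov_add_left: "cov (c + c') d = cov c d + cov c' d"
  unfolding cov_def inner_add_left distrib_right
  by (intro Bochner_Integration.integral_add sq_integrable_mult_integrable sq_integrable_inner)

lemma cov_minus_left: "cov (- c) d = - cov c d"
  unfolding cov_def by simp

lemma cov_minus_right: "cov d (- c) = - cov d c"
  by (simp add: cov_commute[of d] cov_minus_left)

lemma cov_add_right: "cov d (c + c') = cov d c + cov d c'"
  by (simp add: cov_commute[of d] cov_add_left)

text \<open>Stated with plus signs only; the other sign patterns arise by substituting
  \<open>- c2\<close>, \<open>- c3\<close> or \<open>- c4\<close>.\<close>

lemma cov_quadratic:
  "cov (c1 + c2 + c3 + c4) (c1 + c2 + c3 + c4) =
    cov c1 c1 + cov c2 c2 + cov c3 c3 + cov c4 c4 + 2 * cov c1 c2 + 2 * cov c1 c3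
    + 2 * cov c1 c4 + 2 * cov c2 c3 + 2 * cov c2 c4 + 2 * cov c3 c4"
  by (simp add: cov_add_left cov_add_right cov_commute[of c2 c1] cov_commute[of c3 c1]
    cov_commute[of c4 c1] cov_commute[of c3 c2] cov_commute[of c4 c2] cov_commute[of c4 c3])

lemma fourth_moment: "expectation (\<lambda>\<omega>. (c \<bullet> Z \<omega>) ^ 4) = 3 * (cov c c)\<^sup>2"
  using inner_moments(3)[of c] by (simp add: cov_def power2_eq_square)

text \<open>The left side sums e2 e3 e4 (a + e2 b + e3 c + e4 d)^4 over all signs e2, e3, e4. Only
  monomials odd in each of b, c, d survive, which in degree 4 leaves a b c d. The constant is 8 sign
  patterns times 4!.\<close>

lemma quartic_polarization:
  fixes a b c d :: real
  shows "(a + b + c + d) ^ 4 - (a + b + c - d) ^ 4 - (a + b - c + d) ^ 4 + (a + b - c - d) ^ 4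
    - (a - b + c + d) ^ 4 + (a - b + c - d) ^ 4 + (a - b - c + d) ^ 4 - (a - b - c - d) ^ 4
    = 192 * (a * b * (c * d))"
  by algebra

text \<open>The same signed sum on the covariance side: \<open>S\<close> stands for the sum of the
  variances, and \<open>p\<close>, \<open>q\<close>, \<open>r\<close>, \<open>s\<close>,
  \<open>t\<close>, \<open>u\<close> for twice the covariances of the pairs 12, 13, 14, 23, 24, 34.
  Only products of complementary pairs survive, and 48 = 3 * 2 * 8.\<close>

lemma squared_quadratic_polarization:
  fixes S p q r s t u :: real
  shows "3 * (S + p + q + r + s + t + u)\<^sup>2 - 3 * (S + p + q - r + s - t - u)\<^sup>2
    - 3 * (S + p - q + r - s + t - u)\<^sup>2 + 3 * (S + p - q - r - s - t + u)\<^sup>2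
    - 3 * (S - p + q + r - s - t + u)\<^sup>2 + 3 * (S - p + q - r - s + t - u)\<^sup>2
    + 3 * (S - p - q + r + s - t - u)\<^sup>2 - 3 * (S - p - q - r + s + t + u)\<^sup>2
    = 48 * (p * u + q * t + r * s)"
  by algebra

text \<open>Polarization of the quartic form \<open>c \<mapsto> E[(c \<bullet> Z)\<^sup>4]\<close>.\<close>

lemma isserlis_real:
  "expectation (\<lambda>\<omega>. (c1 \<bullet> Z \<omega>) * (c2 \<bullet> Z \<omega>) * ((c3 \<bullet> Z \<omega>) * (c4 \<bullet> Z \<omega>))) =
    cov c1 c2 * cov c3 c4 + cov c1 c3 * cov c2 c4 + cov c1 c4 * cov c2 c3"
proof -
  let ?q = "\<lambda>c \<omega>. (c \<bullet> Z \<omega>) ^ 4"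
  have int: "integrable M (?q c)" for c by (rule inner_moments(2))
  have "192 * expectation (\<lambda>\<omega>. (c1 \<bullet> Z \<omega>) * (c2 \<bullet> Z \<omega>) * ((c3 \<bullet> Z \<omega>) * (c4 \<bullet> Z \<omega>)))
    = expectation (\<lambda>\<omega>. ?q (c1 + c2 + c3 + c4) \<omega> - ?q (c1 + c2 + c3 - c4) \<omega>
       - ?q (c1 + c2 - c3 + c4) \<omega> + ?q (c1 + c2 - c3 - c4) \<omega>
       - ?q (c1 - c2 + c3 + c4) \<omega> + ?q (c1 - c2 + c3 - c4) \<omega>
       + ?q (c1 - c2 - c3 + c4) \<omega> - ?q (c1 - c2 - c3 - c4) \<omega>)"
    unfolding integral_mult_right_zero[symmetric]
    by (rule Bochner_Integration.integral_cong[OF refl])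
      (simp only: quartic_polarization[symmetric] inner_add_left inner_diff_left)
  also have "\<dots> = 3 * (cov (c1 + c2 + c3 + c4) (c1 + c2 + c3 + c4))\<^sup>2
       - 3 * (cov (c1 + c2 + c3 - c4) (c1 + c2 + c3 - c4))\<^sup>2
       - 3 * (cov (c1 + c2 - c3 + c4) (c1 + c2 - c3 + c4))\<^sup>2
       + 3 * (cov (c1 + c2 - c3 - c4) (c1 + c2 - c3 - c4))\<^sup>2
       - 3 * (cov (c1 - c2 + c3 + c4) (c1 - c2 + c3 + c4))\<^sup>2
       + 3 * (cov (c1 - c2 + c3 - c4) (c1 - c2 + c3 - c4))\<^sup>2
       + 3 * (cov (c1 - c2 - c3 + c4) (c1 - c2 - c3 + c4))\<^sup>2
       - 3 * (cov (c1 - c2 - c3 - c4) (c1 - c2 - c3 - c4))\<^sup>2"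
    by (simp add: int fourth_moment)
  \<comment> \<open>The signs move from the vectors into the covariances. The doubled covariances
    contribute a further factor 4, and 48 * 4 matches the 192 of the quartic side.\<close>
  also have "\<dots> = 48 * ((2 * cov c1 c2) * (2 * cov c3 c4)
      + (2 * cov c1 c3) * (2 * cov c2 c4) + (2 * cov c1 c4) * (2 * cov c2 c3))"
    using cov_quadratic[of c1 c2 c3 c4] cov_quadratic[of c1 c2 c3 "- c4"]
      cov_quadratic[of c1 c2 "- c3" c4] cov_quadratic[of c1 c2 "- c3" "- c4"]
      cov_quadratic[of c1 "- c2" c3 c4] cov_quadratic[of c1 "- c2" c3 "- c4"]
      cov_quadratic[of c1 "- c2" "- c3" c4] cov_quadratic[of c1 "- c2" "- c3" "- c4"]
    unfolding squared_quadratic_polarization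
      [of "cov c1 c1 + cov c2 c2 + cov c3 c3 + cov c4 c4", symmetric]
    by (simp only: cov_minus_left cov_minus_right minus_minus mult_minus_right
      add_uminus_conv_diff diff_minus_eq_add)
  finally show ?thesis by simp
qed

section \<open>From real to complex linear forms\<close>

definition complex_linear :: "('w \<Rightarrow> complex) \<Rightarrow> bool"
  where "complex_linear U \<longleftrightarrow>
    (\<exists>c d. U = (\<lambda>\<omega>. complex_of_real (c \<bullet> Z \<omega>) + \<i> * complex_of_real (d \<bullet> Z \<omega>)))"

lemma complex_linear_of_real: "complex_linear (\<lambda>\<omega>. complex_of_real (c \<bullet> Z \<omega>))"
  unfolding complex_linear_def by (rule exI[of _ c], rule exI[of _ 0]) simp

lemma nth_eq_inner:
  "Z \<omega> $ i = complex_of_real (axis i 1 \<bullet> Z \<omega>) + \<i> * complex_of_real (axis i \<i> \<bullet> Z \<omega>)"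
  by (auto simp: inner_axis' complex_eq_iff inner_complex_def)

lemma complex_linear_nth: "complex_linear (\<lambda>\<omega>. Z \<omega> $ i)"
  unfolding complex_linear_def nth_eq_inner by blast

text \<open>This closure is the reason why \<open>complex_linear\<close> means linear over the
  reals: the moments below mix entries of \<open>Z\<close> with conjugated entries.\<close>

lemma complex_linear_cnj: "complex_linear U \<Longrightarrow> complex_linear (\<lambda>\<omega>. cnj (U \<omega>))"
proof -
  assume "complex_linear U"
  then obtain c d where "U = (\<lambda>\<omega>. complex_of_real (c \<bullet> Z \<omega>) + \<i> * complex_of_real (d \<bullet> Z \<omega>))"
    unfolding complex_linear_def by blast
  then have "(\<lambda>\<omega>. cnj (U \<omega>)) =
      (\<lambda>\<omega>. complex_of_real (c \<bullet> Z \<omega>) + \<i> * complex_of_real ((- d) \<bullet> Z \<omega>))"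
    by (auto simp: complex_eq_iff)
  then show ?thesis unfolding complex_linear_def by blast
qed

lemma complex_linear_sq_integrable: "complex_linear U \<Longrightarrow> sq_integrable M U"
  unfolding complex_linear_def
  by (auto intro!: sq_integrable_add sq_integrable_cmult sq_integrable_of_real sq_integrable_inner)

lemma complex_linear_mult_sq_integrable:
  assumes "complex_linear U" "complex_linear V"
  shows "sq_integrable M (\<lambda>\<omega>. U \<omega> * V \<omega>)"
proof -
  obtain c d c' d' where
    "U = (\<lambda>\<omega>. complex_of_real (c \<bullet> Z \<omega>) + \<i> * complex_of_real (d \<bullet> Z \<omega>))"
    "V = (\<lambda>\<omega>. complex_of_real (c' \<bullet> Z \<omega>) + \<i> * complex_of_real (d' \<bullet> Z \<omega>))"
    using assms unfolding complex_linear_def by blast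
  then have eq: "(\<lambda>\<omega>. U \<omega> * V \<omega>) = (\<lambda>\<omega>.
      complex_of_real ((c \<bullet> Z \<omega>) * (c' \<bullet> Z \<omega>)) + \<i> * complex_of_real ((d \<bullet> Z \<omega>) * (c' \<bullet> Z \<omega>))
      + (\<i> * complex_of_real ((c \<bullet> Z \<omega>) * (d' \<bullet> Z \<omega>))
      + (-1) * complex_of_real ((d \<bullet> Z \<omega>) * (d' \<bullet> Z \<omega>))))"
    by (auto simp: algebra_simps)
  show ?thesis
    unfolding eq by (intro sq_integrable_add sq_integrable_cmult sq_integrable_of_real sq_integrable_inner_mult)
qed

lemma expectation_nth: "expectation (\<lambda>\<omega>. Z \<omega> $ i) = 0"
  unfolding nth_eq_inner by (simp add: integrable_inner expectation_inner)

text \<open>A predicate of the four factors allows them to be treated one at a time. The bracketing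
  presents the integrand as a product of two square-integrable variables.\<close>

definition isserlis ::
    "('w \<Rightarrow> complex) \<Rightarrow> ('w \<Rightarrow> complex) \<Rightarrow> ('w \<Rightarrow> complex) \<Rightarrow> ('w \<Rightarrow> complex) \<Rightarrow> bool"
  where "isserlis A B C D \<longleftrightarrow>
    expectation (\<lambda>\<omega>. A \<omega> * B \<omega> * (C \<omega> * D \<omega>)) =
      expectation (\<lambda>\<omega>. A \<omega> * B \<omega>) * expectation (\<lambda>\<omega>. C \<omega> * D \<omega>)
    + expectation (\<lambda>\<omega>. A \<omega> * C \<omega>) * expectation (\<lambda>\<omega>. B \<omega> * D \<omega>)
    + expectation (\<lambda>\<omega>. A \<omega> * D \<omega>) * expectation (\<lambda>\<omega>. B \<omega> * C \<omega>)"

text \<open>Rotation permutes the three pairings. It brings each factor in turn to the first place,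
  the one that \<open>isserlis_slot\<close> handles.\<close>

lemma isserlis_rotate: "isserlis A B C D \<longleftrightarrow> isserlis B C D A"
  by (simp add: isserlis_def ac_simps)

text \<open>Both sides are complex-linear in the first factor, so the formula passes from the real
  and imaginary parts of \<open>U\<close> to \<open>U\<close> itself.\<close>

lemma isserlis_slot:
  assumes U: "complex_linear U" and lin: "complex_linear B" "complex_linear C" "complex_linear D"
    and real: "\<And>c. isserlis (\<lambda>\<omega>. complex_of_real (c \<bullet> Z \<omega>)) B C D"
  shows "isserlis U B C D"
proof -
  obtain c d where Ueq: "U = (\<lambda>\<omega>. complex_of_real (c \<bullet> Z \<omega>) + \<i> * complex_of_real (d \<bullet> Z \<omega>))"
    using U unfolding complex_linear_def by blast
  let ?X = "\<lambda>\<omega>. complex_of_real (c \<bullet> Z \<omega>)" and ?Y = "\<lambda>\<omega>. complex_of_real (d \<bullet> Z \<omega>)"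
  note L = complex_linear_of_real
  have 2: "expectation (\<lambda>\<omega>. U \<omega> * V \<omega>) =
      expectation (\<lambda>\<omega>. ?X \<omega> * V \<omega>) + \<i> * expectation (\<lambda>\<omega>. ?Y \<omega> * V \<omega>)"
    if "complex_linear V" for V
    unfolding Ueq distrib_right mult.assoc
    by (subst Bochner_Integration.integral_add)
       (auto intro!: sq_integrable_mult_integrable[of M "\<lambda>\<omega>. complex_of_real (_ \<bullet> Z \<omega>)"]
         complex_linear_sq_integrable L that)
  have 4: "expectation (\<lambda>\<omega>. U \<omega> * B \<omega> * (C \<omega> * D \<omega>)) =
      expectation (\<lambda>\<omega>. ?X \<omega> * B \<omega> * (C \<omega> * D \<omega>)) + \<i> * expectation (\<lambda>\<omega>. ?Y \<omega> * B \<omega> * (C \<omega> * D \<omega>))"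
  proof -
    have "integrable M (\<lambda>\<omega>. complex_of_real (e \<bullet> Z \<omega>) * B \<omega> * (C \<omega> * D \<omega>))" for e
      by (intro sq_integrable_mult_integrable complex_linear_mult_sq_integrable L lin)
    then show ?thesis
      unfolding Ueq distrib_right
      by (subst Bochner_Integration.integral_add) (auto simp: mult.assoc)
  qed
  show ?thesis
    using real[of c] real[of d] unfolding isserlis_def 4 2[OF lin(1)] 2[OF lin(2)] 2[OF lin(3)]
    by (simp add: algebra_simps)
qed

lemma isserlis_of_real:
  "isserlis (\<lambda>\<omega>. complex_of_real (c1 \<bullet> Z \<omega>)) (\<lambda>\<omega>. complex_of_real (c2 \<bullet> Z \<omega>))
    (\<lambda>\<omega>. complex_of_real (c3 \<bullet> Z \<omega>)) (\<lambda>\<omega>. complex_of_real (c4 \<bullet> Z \<omega>))"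
  unfolding isserlis_def of_real_mult[symmetric] integral_complex_of_real of_real_add[symmetric]
    isserlis_real cov_def[symmetric]
  by simp

text \<open>Four rounds of \<open>isserlis_slot\<close>, each making one more factor complex; a
  rotation between rounds supplies the hypothesis of the next.\<close>

lemma isserlis_complex:
  assumes lin: "complex_linear A" "complex_linear B" "complex_linear C" "complex_linear D"
  shows "isserlis A B C D"
proof -
  note L = complex_linear_of_real
  have 1: "isserlis A (\<lambda>\<omega>. complex_of_real (c2 \<bullet> Z \<omega>)) (\<lambda>\<omega>. complex_of_real (c3 \<bullet> Z \<omega>))
      (\<lambda>\<omega>. complex_of_real (c4 \<bullet> Z \<omega>))" for c2 c3 c4
    by (rule isserlis_slot[OF lin(1) L L L isserlis_of_real])
  have 2: "isserlis B (\<lambda>\<omega>. complex_of_real (c3 \<bullet> Z \<omega>)) (\<lambda>\<omega>. complex_of_real (c4 \<bullet> Z \<omega>)) A" for c3 c4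
    by (rule isserlis_slot[OF lin(2) L L lin(1)]) (use 1 isserlis_rotate in blast)
  have 3: "isserlis C (\<lambda>\<omega>. complex_of_real (c4 \<bullet> Z \<omega>)) A B" for c4
    by (rule isserlis_slot[OF lin(3) L lin(1,2)]) (use 2 isserlis_rotate in blast)
  have "isserlis D A B C"
    by (rule isserlis_slot[OF lin(4,1,2,3)]) (use 3 isserlis_rotate in blast)
  then show ?thesis using isserlis_rotate by blast
qed

end

section \<open>Second moments of a single link\<close>

lemma integrable_vec:
  fixes f :: "'w \<Rightarrow> 'b::euclidean_space ^ 'n"
  assumes "\<And>i. integrable M (\<lambda>\<omega>. f \<omega> $ i)"
  shows "integrable M f"
proof (rule integrable_euclidean_componentwise)
  fix u :: "'b ^ 'n" assume "u \<in> Basis"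
  then obtain i v where "u = axis i v" by (auto simp: Basis_vec_def)
  then show "integrable M (\<lambda>\<omega>. u \<bullet> f \<omega>)"
    using integrable_inner_right[OF assms[of i], of v] by (simp add: inner_axis')
qed

lemma measurable_vec_nth [measurable]:
  "(\<lambda>x :: 'b::euclidean_space ^ 'n. x $ i) \<in> borel_measurable borel"
  by (intro borel_measurable_continuous_onI continuous_intros)

text \<open>Reading off an entry is bounded linear, hence commutes with the matrix-valued integral
  once the outer product is integrable. This turns the matrix conditions of
  \<open>circ_complex_gaussian\<close> into scalar ones.\<close>

lemma sq_integrable_outer_nth:
  assumes "\<And>a. sq_integrable M (\<lambda>\<omega>. X \<omega> $ a)" "\<And>b. sq_integrable M (\<lambda>\<omega>. Y \<omega> $ b)"
  shows "(\<integral>\<omega>. outer (X \<omega>) (Y \<omega>) \<partial>M) $ a $ b = (\<integral>\<omega>. X \<omega> $ a * cnj (Y \<omega> $ b) \<partial>M)"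
proof -
  have int: "integrable M (\<lambda>\<omega>. outer (X \<omega>) (Y \<omega>))"
    by (intro integrable_vec) (auto simp: outer_def
      intro!: sq_integrable_mult_integrable[of M "\<lambda>\<omega>. X \<omega> $ _"] sq_integrable_cnj assms)
  have "bounded_linear (\<lambda>A :: complex ^ _ ^ _. A $ a $ b)"
    using bounded_linear_compose[OF bounded_linear_vec_nth bounded_linear_vec_nth] .
  from integral_bounded_linear[OF this int] show ?thesis
    by (simp add: outer_def)
qed

lemma cdot_matrix_vector:
  "cdot x (A *v y) = (\<Sum>a\<in>UNIV. \<Sum>b\<in>UNIV. A $ a $ b * (cnj (x $ a) * y $ b))"
  by (simp add: cdot_def matrix_vector_mult_def sum_distrib_left ac_simps)

lemma trace_matrix_mult:
  "trace (A ** B) = (\<Sum>a\<in>UNIV. \<Sum>b\<in>UNIV. A $ a $ b * B $ b $ a)"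
  by (simp add: trace_def matrix_matrix_mult_def)

text \<open>The order of summation \<open>a\<close>, \<open>c\<close>, \<open>b\<close>,
  \<open>d\<close> is the one in which the squared modulus of a double sum expands in
  \<open>link_second_moment\<close>.\<close>

lemma trace_sandwich:
  "trace (A ** Q ** conj_transpose A ** R) = (\<Sum>a\<in>UNIV. \<Sum>c\<in>UNIV. \<Sum>b\<in>UNIV. \<Sum>d\<in>UNIV.
    A $ a $ b * cnj (A $ c $ d) * (R $ c $ a * Q $ b $ d))"
  unfolding trace_matrix_mult
proof (intro sum.cong refl)
  fix a c
  have "(A ** Q ** conj_transpose A) $ a $ c * R $ c $ a =
      (\<Sum>d\<in>UNIV. \<Sum>b\<in>UNIV. A $ a $ b * cnj (A $ c $ d) * (R $ c $ a * Q $ b $ d))"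
    by (simp add: matrix_matrix_mult_def conj_transpose_def sum_distrib_right sum_distrib_left ac_simps)
  also have "\<dots> = (\<Sum>b\<in>UNIV. \<Sum>d\<in>UNIV. A $ a $ b * cnj (A $ c $ d) * (R $ c $ a * Q $ b $ d))"
    by (rule sum.swap)
  finally show "(A ** Q ** conj_transpose A) $ a $ c * R $ c $ a = \<dots>" .
qed

text \<open>Of \<open>z\<close> only second moments, zero mean and independence of \<open>H\<close>
  are recorded. Its covariance is never computed; \<open>y_cov\<close> trades it for the covariance
  of \<open>y\<close>.\<close>

locale gaussian_link = centered_gaussian M H for M :: "'w measure" and H :: "'w \<Rightarrow> complex ^ 'm" +
  fixes R :: "complex ^ 'm ^ 'm" and z y :: "'w \<Rightarrow> complex ^ 'm" and d :: complex
  assumes H: "circ_complex_gaussian M H R"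
    and z: "\<And>a. sq_integrable M (\<lambda>\<omega>. z \<omega> $ a)" "\<And>a. expectation (\<lambda>\<omega>. z \<omega> $ a) = 0"
    and indep: "indep_var borel H borel z"
    and y: "\<And>a \<omega>. y \<omega> $ a = d * H \<omega> $ a + z \<omega> $ a"
begin

lemma H_sq_integrable: "sq_integrable M (\<lambda>\<omega>. H \<omega> $ a)"
  by (rule complex_linear_sq_integrable[OF complex_linear_nth])

lemma H_cov: "expectation (\<lambda>\<omega>. H \<omega> $ a * cnj (H \<omega> $ b)) = R $ a $ b"
  using H sq_integrable_outer_nth[OF H_sq_integrable H_sq_integrable, of a b]
  by (simp add: circ_complex_gaussian_def)

lemma H_cov_cnj_left: "expectation (\<lambda>\<omega>. cnj (H \<omega> $ a) * H \<omega> $ b) = R $ b $ a"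
  using H_cov[of b a] by (simp add: mult.commute)

lemma H_pseudo_cov: "expectation (\<lambda>\<omega>. H \<omega> $ a * H \<omega> $ b) = 0"
proof -
  have "sq_integrable M (\<lambda>\<omega>. cnj_vec (H \<omega>) $ b)" for b
    by (simp add: cnj_vec_def sq_integrable_cnj H_sq_integrable)
  from sq_integrable_outer_nth[OF H_sq_integrable this, of a b] H show ?thesis
    by (simp add: circ_complex_gaussian_def cnj_vec_def)
qed

lemma H_pseudo_cov_cnj: "expectation (\<lambda>\<omega>. cnj (H \<omega> $ a) * cnj (H \<omega> $ b)) = 0"
proof -
  have "expectation (\<lambda>\<omega>. cnj (H \<omega> $ a) * cnj (H \<omega> $ b)) = cnj (expectation (\<lambda>\<omega>. H \<omega> $ a * H \<omega> $ b))"
    unfolding Bochner_Integration.integral_cnj[symmetric] by simp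
  then show ?thesis by (simp add: H_pseudo_cov)
qed

lemma indep_functions:
  assumes "f \<in> borel_measurable borel" "g \<in> borel_measurable borel"
  shows "indep_var borel (\<lambda>\<omega>. f (H \<omega>) :: complex) borel (\<lambda>\<omega>. g (z \<omega>) :: complex)"
  using indep_var_compose[OF indep assms] by (simp add: o_def)

text \<open>Independence factors the expectation, and \<open>z\<close> is centred. A general
  \<open>f\<close> covers the products of three channel entries that occur in the fourth
  moments.\<close>

lemma expectation_mult_z:
  assumes f: "f \<in> borel_measurable borel" and int: "integrable M (\<lambda>\<omega>. f (H \<omega>))"
  shows "expectation (\<lambda>\<omega>. f (H \<omega>) * z \<omega> $ b) = 0"
    "expectation (\<lambda>\<omega>. f (H \<omega>) * cnj (z \<omega> $ b)) = 0"
proof -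
  have g: "(\<lambda>x. cnj (x $ b)) \<in> borel_measurable borel"
    by measurable
  show "expectation (\<lambda>\<omega>. f (H \<omega>) * z \<omega> $ b) = 0"
    using indep_var_lebesgue_integral[OF indep_functions[OF f measurable_vec_nth[of b]] int
        sq_integrable_integrable[OF z(1)]] z(2) by simp
  show "expectation (\<lambda>\<omega>. f (H \<omega>) * cnj (z \<omega> $ b)) = 0"
    using indep_var_lebesgue_integral[OF indep_functions[OF f g] int] z(2)[of b]
      sq_integrable_integrable[OF z(1)[of b]] by simp
qed

section \<open>Moments of the observation and of its products with the channel\<close>

lemma y_sq_integrable: "sq_integrable M (\<lambda>\<omega>. y \<omega> $ a)"
  unfolding y by (intro sq_integrable_add sq_integrable_cmult H_sq_integrable z(1))

lemma H_mult_z_sq_integrable: "sq_integrable M (\<lambda>\<omega>. cnj (H \<omega> $ a) * z \<omega> $ b)"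
  by (rule sq_integrable_indep_mult[OF indep_functions])
    (auto intro!: sq_integrable_cnj H_sq_integrable z(1))

lemma H_mult_y_sq_integrable: "sq_integrable M (\<lambda>\<omega>. cnj (H \<omega> $ a) * y \<omega> $ b)"
proof -
  have "sq_integrable M (\<lambda>\<omega>. d * (cnj (H \<omega> $ a) * H \<omega> $ b) + cnj (H \<omega> $ a) * z \<omega> $ b)"
    by (intro sq_integrable_add sq_integrable_cmult H_mult_z_sq_integrable
        complex_linear_mult_sq_integrable complex_linear_cnj complex_linear_nth)
  then show ?thesis unfolding y by (simp add: algebra_simps)
qed

lemma H_y_cov: "expectation (\<lambda>\<omega>. cnj (H \<omega> $ a) * y \<omega> $ b) = d * R $ b $ a"
proof -
  have "expectation (\<lambda>\<omega>. cnj (H \<omega> $ a) * y \<omega> $ b) =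
      expectation (\<lambda>\<omega>. d * (cnj (H \<omega> $ a) * H \<omega> $ b) + cnj (H \<omega> $ a) * z \<omega> $ b)"
    unfolding y by (simp add: algebra_simps)
  also have "\<dots> = d * expectation (\<lambda>\<omega>. cnj (H \<omega> $ a) * H \<omega> $ b)
      + expectation (\<lambda>\<omega>. cnj (H \<omega> $ a) * z \<omega> $ b)"
    by (subst Bochner_Integration.integral_add)
      (auto intro!: sq_integrable_mult_integrable[of M "\<lambda>\<omega>. cnj (H \<omega> $ _)"]
        sq_integrable_cnj H_sq_integrable z(1))
  also have "expectation (\<lambda>\<omega>. cnj (H \<omega> $ a) * z \<omega> $ b) = 0"
    by (rule expectation_mult_z(1))
      (auto intro!: sq_integrable_integrable sq_integrable_cnj H_sq_integrable)
  finally show ?thesis by (simp add: H_cov_cnj_left)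
qed

lemma y_cov:
  "expectation (\<lambda>\<omega>. y \<omega> $ b * cnj (y \<omega> $ e)) =
    d * cnj d * R $ b $ e + expectation (\<lambda>\<omega>. z \<omega> $ b * cnj (z \<omega> $ e))"
proof -
  note sq = sq_integrable_mult_integrable sq_integrable_cnj H_sq_integrable z(1)
  have 0: "expectation (\<lambda>\<omega>. H \<omega> $ b * cnj (z \<omega> $ e)) = 0"
    by (rule expectation_mult_z(2)) (auto intro!: sq_integrable_integrable H_sq_integrable)
  have 1: "expectation (\<lambda>\<omega>. cnj (H \<omega> $ e) * z \<omega> $ b) = 0"
    by (rule expectation_mult_z(1))
      (auto intro!: sq_integrable_integrable sq_integrable_cnj H_sq_integrable)
  have i: "integrable M (\<lambda>\<omega>. H \<omega> $ b * cnj (H \<omega> $ e))" "integrable M (\<lambda>\<omega>. H \<omega> $ b * cnj (z \<omega> $ e))"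
    "integrable M (\<lambda>\<omega>. cnj (H \<omega> $ e) * z \<omega> $ b)" "integrable M (\<lambda>\<omega>. z \<omega> $ b * cnj (z \<omega> $ e))"
    by (intro sq)+
  have "expectation (\<lambda>\<omega>. y \<omega> $ b * cnj (y \<omega> $ e)) =
      expectation (\<lambda>\<omega>. d * cnj d * (H \<omega> $ b * cnj (H \<omega> $ e)) + d * (H \<omega> $ b * cnj (z \<omega> $ e))
        + cnj d * (cnj (H \<omega> $ e) * z \<omega> $ b) + z \<omega> $ b * cnj (z \<omega> $ e))"
    unfolding y by (simp add: algebra_simps)
  also have "\<dots> = d * cnj d * expectation (\<lambda>\<omega>. H \<omega> $ b * cnj (H \<omega> $ e))
      + d * expectation (\<lambda>\<omega>. H \<omega> $ b * cnj (z \<omega> $ e))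
      + cnj d * expectation (\<lambda>\<omega>. cnj (H \<omega> $ e) * z \<omega> $ b)
      + expectation (\<lambda>\<omega>. z \<omega> $ b * cnj (z \<omega> $ e))"
    using i by simp
  finally show ?thesis by (simp add: H_cov 0 1)
qed

text \<open>Inserting y = d H + z leaves four terms. Those with a single factor \<open>z\<close>
  vanish, the one with two such factors splits by independence, and the pure channel term is given
  by the Isserlis formula. Its second pairing joins the \<open>z\<close> term to form the covariance
  of \<open>y\<close> by \<open>y_cov\<close>.\<close>

lemma fourth_moment_entries:
  "expectation (\<lambda>\<omega>. cnj (H \<omega> $ a) * y \<omega> $ b * cnj (cnj (H \<omega> $ c) * y \<omega> $ e)) =
    (d * R $ b $ a) * cnj (d * R $ e $ c)
    + R $ c $ a * expectation (\<lambda>\<omega>. y \<omega> $ b * cnj (y \<omega> $ e))"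
proof -
  let ?A = "\<lambda>\<omega>. cnj (H \<omega> $ a)" and ?B = "\<lambda>\<omega>. H \<omega> $ b" and ?C = "\<lambda>\<omega>. H \<omega> $ c"
    and ?E = "\<lambda>\<omega>. cnj (H \<omega> $ e)"
  note lin = complex_linear_cnj complex_linear_nth
  note sq2 = complex_linear_mult_sq_integrable
  note sq = complex_linear_sq_integrable
  have i3: "integrable M (\<lambda>\<omega>. ?A \<omega> * ?B \<omega> * ?C \<omega>)" "integrable M (\<lambda>\<omega>. ?A \<omega> * ?E \<omega> * ?C \<omega>)"
    by (intro sq_integrable_mult_integrable sq2 sq lin)+
  have 0: "expectation (\<lambda>\<omega>. ?A \<omega> * ?B \<omega> * ?C \<omega> * cnj (z \<omega> $ e)) = 0"
    by (rule expectation_mult_z(2)[where f = "\<lambda>x. cnj (x $ a) * x $ b * x $ c"])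
      (use i3 in auto)
  have 1: "expectation (\<lambda>\<omega>. ?A \<omega> * ?E \<omega> * ?C \<omega> * z \<omega> $ b) = 0"
    by (rule expectation_mult_z(1)[where f = "\<lambda>x. cnj (x $ a) * cnj (x $ e) * x $ c"])
      (use i3 in auto)
  have 2: "expectation (\<lambda>\<omega>. (?A \<omega> * ?C \<omega>) * (z \<omega> $ b * cnj (z \<omega> $ e))) =
      R $ c $ a * expectation (\<lambda>\<omega>. z \<omega> $ b * cnj (z \<omega> $ e))"
    by (subst indep_var_lebesgue_integral[OF indep_functions
          [where f = "\<lambda>x. cnj (x $ a) * x $ c" and g = "\<lambda>x. x $ b * cnj (x $ e)"]])
      (auto simp: H_cov_cnj_left intro!: sq_integrable_mult_integrable sq_integrable_cnj z(1)
        H_sq_integrable)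
  \<comment> \<open>The pairing of \<open>?A\<close> with \<open>?E\<close> and of \<open>?B\<close>
    with \<open>?C\<close> drops out because the pseudo-covariance is zero.\<close>
  have 3: "expectation (\<lambda>\<omega>. ?A \<omega> * ?B \<omega> * (?C \<omega> * ?E \<omega>)) = R $ b $ a * R $ c $ e + R $ c $ a * R $ b $ e"
    using isserlis_complex[of ?A ?B ?C ?E]
    by (simp add: isserlis_def lin H_cov H_cov_cnj_left H_pseudo_cov_cnj)
  \<comment> \<open>Hermitian symmetry of \<open>R\<close>, read off from its being a covariance; it
    makes the first pairing a mean times a conjugated mean.\<close>
  have R: "R $ c $ e = cnj (R $ e $ c)"
    unfolding H_cov[symmetric] Bochner_Integration.integral_cnj[symmetric] by (simp add: mult.commute)
  have i4: "integrable M (\<lambda>\<omega>. ?A \<omega> * ?B \<omega> * (?C \<omega> * ?E \<omega>))"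
    by (intro sq_integrable_mult_integrable sq2 lin)
  have cz: "sq_integrable M (\<lambda>\<omega>. ?C \<omega> * cnj (z \<omega> $ e))"
    using sq_integrable_cnj[OF H_mult_z_sq_integrable[of c e]] by simp
  have i0: "integrable M (\<lambda>\<omega>. ?A \<omega> * ?B \<omega> * (?C \<omega> * cnj (z \<omega> $ e)))"
    by (intro sq_integrable_mult_integrable sq2 lin cz)
  have i1: "integrable M (\<lambda>\<omega>. ?A \<omega> * z \<omega> $ b * (?E \<omega> * ?C \<omega>))"
    by (intro sq_integrable_mult_integrable sq2 lin H_mult_z_sq_integrable)
  have i2: "integrable M (\<lambda>\<omega>. ?A \<omega> * z \<omega> $ b * (?C \<omega> * cnj (z \<omega> $ e)))"
    by (intro sq_integrable_mult_integrable H_mult_z_sq_integrable cz)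
  have "expectation (\<lambda>\<omega>. cnj (H \<omega> $ a) * y \<omega> $ b * cnj (cnj (H \<omega> $ c) * y \<omega> $ e)) =
      expectation (\<lambda>\<omega>. d * cnj d * (?A \<omega> * ?B \<omega> * (?C \<omega> * ?E \<omega>))
        + d * (?A \<omega> * ?B \<omega> * (?C \<omega> * cnj (z \<omega> $ e)))
        + cnj d * (?A \<omega> * z \<omega> $ b * (?E \<omega> * ?C \<omega>))
        + ?A \<omega> * z \<omega> $ b * (?C \<omega> * cnj (z \<omega> $ e)))"
    unfolding y by (simp add: algebra_simps)
  also have "\<dots> = d * cnj d * expectation (\<lambda>\<omega>. ?A \<omega> * ?B \<omega> * (?C \<omega> * ?E \<omega>))
        + d * expectation (\<lambda>\<omega>. ?A \<omega> * ?B \<omega> * (?C \<omega> * cnj (z \<omega> $ e)))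
        + cnj d * expectation (\<lambda>\<omega>. ?A \<omega> * z \<omega> $ b * (?E \<omega> * ?C \<omega>))
        + expectation (\<lambda>\<omega>. ?A \<omega> * z \<omega> $ b * (?C \<omega> * cnj (z \<omega> $ e)))"
    using i0 i1 i2 i4 by simp
  also have "\<dots> = d * cnj d * (R $ b $ a * R $ c $ e + R $ c $ a * R $ b $ e)
      + R $ c $ a * expectation (\<lambda>\<omega>. z \<omega> $ b * cnj (z \<omega> $ e))"
    using 0 1 2 3 by (simp add: ac_simps)
  finally show ?thesis by (simp add: R y_cov algebra_simps)
qed

lemma link_sq_integrable: "sq_integrable M (\<lambda>\<omega>. cdot (H \<omega>) (W *v y \<omega>))"
  unfolding cdot_matrix_vector
  by (intro sq_integrable_sum sq_integrable_cmult H_mult_y_sq_integrable)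

lemma link_mean: "expectation (\<lambda>\<omega>. cdot (H \<omega>) (W *v y \<omega>)) = d * trace (W ** R)"
proof -
  have "integrable M (\<lambda>\<omega>. cnj (H \<omega> $ a) * y \<omega> $ b)" for a b
    by (rule sq_integrable_integrable[OF H_mult_y_sq_integrable])
  then have "expectation (\<lambda>\<omega>. cdot (H \<omega>) (W *v y \<omega>)) =
      (\<Sum>a\<in>UNIV. \<Sum>b\<in>UNIV. W $ a $ b * (d * R $ b $ a))"
    by (simp add: cdot_matrix_vector H_y_cov)
  then show ?thesis
    by (simp add: trace_matrix_mult sum_distrib_left ac_simps)
qed

lemma link_second_moment:
  "expectation (\<lambda>\<omega>. cdot (H \<omega>) (W *v y \<omega>) * cnj (cdot (H \<omega>) (W *v y \<omega>))) =
    d * trace (W ** R) * cnj (d * trace (W ** R))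
    + trace (W ** (\<integral>\<omega>. outer (y \<omega>) (y \<omega>) \<partial>M) ** conj_transpose W ** R)"
proof -
  let ?U = "\<lambda>a b \<omega>. cnj (H \<omega> $ a) * y \<omega> $ b"
  have int: "integrable M (\<lambda>\<omega>. ?U a b \<omega> * cnj (?U c e \<omega>))" for a b c e
    by (intro sq_integrable_mult_integrable sq_integrable_cnj H_mult_y_sq_integrable)
  have tr: "d * trace (W ** R) = (\<Sum>a\<in>UNIV. \<Sum>b\<in>UNIV. W $ a $ b * (d * R $ b $ a))"
    by (simp add: trace_matrix_mult sum_distrib_left ac_simps)
  have expand: "(\<Sum>a\<in>UNIV. \<Sum>b\<in>UNIV. W $ a $ b * u a b) * cnj (\<Sum>a\<in>UNIV. \<Sum>b\<in>UNIV. W $ a $ b * u a b)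
    = (\<Sum>a\<in>UNIV. \<Sum>c\<in>UNIV. \<Sum>b\<in>UNIV. \<Sum>e\<in>UNIV. W $ a $ b * cnj (W $ c $ e) * (u a b * cnj (u c e)))" for u
    by (simp add: sum_product ac_simps)
  have "expectation (\<lambda>\<omega>. cdot (H \<omega>) (W *v y \<omega>) * cnj (cdot (H \<omega>) (W *v y \<omega>))) =
      (\<Sum>a\<in>UNIV. \<Sum>c\<in>UNIV. \<Sum>b\<in>UNIV. \<Sum>e\<in>UNIV. W $ a $ b * cnj (W $ c $ e) *
        expectation (\<lambda>\<omega>. ?U a b \<omega> * cnj (?U c e \<omega>)))"
    unfolding cdot_matrix_vector expand
    by (simp only: Bochner_Integration.integral_sum Bochner_Integration.integrable_sum
        integrable_mult_right int integral_mult_right_zero)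
  also have "\<dots> = (\<Sum>a\<in>UNIV. \<Sum>c\<in>UNIV. \<Sum>b\<in>UNIV. \<Sum>e\<in>UNIV. W $ a $ b * cnj (W $ c $ e) *
        ((d * R $ b $ a) * cnj (d * R $ e $ c)))
      + (\<Sum>a\<in>UNIV. \<Sum>c\<in>UNIV. \<Sum>b\<in>UNIV. \<Sum>e\<in>UNIV. W $ a $ b * cnj (W $ c $ e) *
        (R $ c $ a * expectation (\<lambda>\<omega>. y \<omega> $ b * cnj (y \<omega> $ e))))"
    unfolding fourth_moment_entries by (simp only: distrib_left sum.distrib)
  \<comment> \<open>\<open>expand\<close> also rewrites the squared mean on the right as a fourfold
    sum, and \<open>trace_sandwich\<close> does so for the trace, so both sides agree term by
    term.\<close>
  finally show ?thesis
    unfolding tr expand trace_sandwich sq_integrable_outer_nth[OF y_sq_integrable y_sq_integrable] .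
qed

end

section \<open>Sums over independent sub-arrays\<close>

context prob_space
begin

text \<open>Pairwise independence makes the mixed moments products of means, so the
  \<open>v n\<close> survive on the diagonal only. They are complex because they will be
  traces.\<close>

lemma sum_second_moment:
  fixes X :: "'n::finite \<Rightarrow> 'a \<Rightarrow> complex" and c :: "'n \<Rightarrow> real"
  assumes sq: "\<And>n. sq_integrable M (X n)"
    and indep: "\<And>n n'. n \<noteq> n' \<Longrightarrow> indep_var borel (X n) borel (X n')"
    and var: "\<And>n. expectation (\<lambda>\<omega>. X n \<omega> * cnj (X n \<omega>)) = m n * cnj (m n) + v n"
    and mean: "\<And>n. expectation (X n) = m n"
  shows "complex_of_real (expectation (\<lambda>\<omega>. (cmod (\<Sum>n\<in>UNIV. of_real (c n) * X n \<omega>))\<^sup>2)) =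
    of_real ((cmod (\<Sum>n\<in>UNIV. of_real (c n) * m n))\<^sup>2) + (\<Sum>n\<in>UNIV. of_real ((c n)\<^sup>2) * v n)"
proof -
  have expand: "complex_of_real ((cmod (\<Sum>n\<in>UNIV. of_real (c n) * u n))\<^sup>2) =
      (\<Sum>n\<in>UNIV. \<Sum>n'\<in>UNIV. of_real (c n * c n') * (u n * cnj (u n')))" for u :: "'n \<Rightarrow> complex"
    by (simp add: complex_norm_square sum_product ac_simps del: of_real_power)
  have int: "integrable M (\<lambda>\<omega>. X n \<omega> * cnj (X n' \<omega>))" for n n'
    by (intro sq_integrable_mult_integrable sq_integrable_cnj sq)
  have cov: "expectation (\<lambda>\<omega>. X n \<omega> * cnj (X n' \<omega>)) =
      m n * cnj (m n') + (if n' = n then v n else 0)" for n n'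
  proof (cases "n' = n")
    case False
    have "indep_var borel (id \<circ> X n) borel (cnj \<circ> X n')"
      using False by (intro indep_var_compose[OF indep]) auto
    then have "indep_var borel (X n) borel (\<lambda>\<omega>. cnj (X n' \<omega>))"
      by (simp add: o_def)
    from indep_var_lebesgue_integral[OF this] show ?thesis
      using False by (simp add: sq_integrable_integrable sq mean)
  qed (simp add: var)
  have "complex_of_real (expectation (\<lambda>\<omega>. (cmod (\<Sum>n\<in>UNIV. of_real (c n) * X n \<omega>))\<^sup>2)) =
      (\<Sum>n\<in>UNIV. \<Sum>n'\<in>UNIV. of_real (c n * c n') * expectation (\<lambda>\<omega>. X n \<omega> * cnj (X n' \<omega>)))"
    unfolding integral_complex_of_real[symmetric] expand
    by (simp only: Bochner_Integration.integral_sum Bochner_Integration.integrable_sum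
        integrable_mult_right int integral_mult_right_zero)
  also have "\<dots> = (\<Sum>n\<in>UNIV. \<Sum>n'\<in>UNIV. of_real (c n * c n') * (m n * cnj (m n')))
      + (\<Sum>n\<in>UNIV. of_real ((c n)\<^sup>2) * v n)"
  proof -
    have "of_real (c n * c n') * (if n' = n then v n else 0) =
        (if n' = n then of_real ((c n)\<^sup>2) * v n else 0)" for n n'
      by (simp add: power2_eq_square)
    then show ?thesis
      by (simp only: cov distrib_left sum.distrib) simp
  qed
  finally show ?thesis unfolding expand .
qed

text \<open>Independence within two families and between them as tuples gives independence of the
  joint family. The maps \<open>g j\<close> bring the second family to the value space of the first;
  they will multiply a noise matrix by a pilot.\<close>

lemma indep_vars_Plus:
  fixes X :: "'i::finite \<Rightarrow> 'a \<Rightarrow> 'b" and Y :: "'j::finite \<Rightarrow> 'a \<Rightarrow> 'c"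
  assumes X: "indep_vars (\<lambda>_. N) X UNIV" and Y: "indep_vars (\<lambda>_. L) Y UNIV"
    and XY: "indep_rvs M (\<Pi>\<^sub>M _\<in>UNIV. N) (\<lambda>\<omega> i. X i \<omega>) (\<Pi>\<^sub>M _\<in>UNIV. L) (\<lambda>\<omega> j. Y j \<omega>)"
    and g: "\<And>j. g j \<in> measurable L N"
  shows "indep_vars (\<lambda>_. N) (case_sum X (\<lambda>j \<omega>. g j (Y j \<omega>))) UNIV"
proof -
  let ?V = "case_sum X (\<lambda>j \<omega>. g j (Y j \<omega>))"
  let ?F = "\<lambda>s. {?V s -` A \<inter> space M | A. A \<in> sets N}"
  have rX: "random_variable N (X i)" for i using X by (simp add: indep_vars_def)
  have rY: "random_variable L (Y j)" for j using Y by (simp add: indep_vars_def)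
  have rV: "random_variable N (?V s)" for s
    using rX measurable_compose[OF rY g] by (cases s) auto
  have "indep_sets ?F UNIV"
  proof (subst indep_sets_finite)
    show "?F s \<subseteq> events" for s using measurable_sets[OF rV] by auto
    show "space M \<in> ?F s" for s
    proof (intro CollectI exI conjI)
      show "space M = ?V s -` space N \<inter> space M"
        using measurable_space[OF rV[of s]] by blast
    qed simp
    show "\<forall>A\<in>Pi UNIV ?F. prob (\<Inter>s\<in>UNIV. A s) = (\<Prod>s\<in>UNIV. prob (A s))"
    proof
      fix A assume A: "A \<in> Pi UNIV ?F"
      have "\<exists>B. B \<in> sets N \<and> A s = ?V s -` B \<inter> space M" for s
      proof -
        have "A s \<in> ?F s" using A by (rule Pi_mem) simp
        then show ?thesis by blast
      qed
      then obtain B where B: "\<And>s. B s \<in> sets N" "\<And>s. A s = ?V s -` B s \<inter> space M"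
        using choice[of "\<lambda>s B. B \<in> sets N \<and> A s = ?V s -` B \<inter> space M"] by blast
      \<comment> \<open>Pulling the target sets back along \<open>g j\<close> expresses the events
        through \<open>Y j\<close> itself, whose independence is given.\<close>
      define C where "C j = g j -` B (Inr j) \<inter> space L" for j
      have C: "C j \<in> sets L" for j unfolding C_def using g B(1) by (rule measurable_sets)
      have Al: "A (Inl i) = X i -` B (Inl i) \<inter> space M" for i using B(2) by simp
      have Ar: "A (Inr j) = Y j -` C j \<inter> space M" for j
        using B(2)[of "Inr j"] measurable_space[OF rY] by (auto simp: C_def)
      \<comment> \<open>A joint event of one family is the preimage of a box, hence lies in the
        product sigma-algebra to which \<open>XY\<close> refers.\<close>
      have l: "(\<Inter>i. A (Inl i)) = (\<lambda>\<omega> i. X i \<omega>) -` (Pi\<^sub>E UNIV (\<lambda>i. B (Inl i))) \<inter> space M"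
        unfolding Al by (auto simp: PiE_UNIV_domain Pi_iff)
      have r: "(\<Inter>j. A (Inr j)) = (\<lambda>\<omega> j. Y j \<omega>) -` (Pi\<^sub>E UNIV C) \<inter> space M"
        unfolding Ar by (auto simp: PiE_UNIV_domain Pi_iff)
      have "(\<Inter>s\<in>UNIV. A s) = (\<Inter>i. A (Inl i)) \<inter> (\<Inter>j. A (Inr j))"
        unfolding UNIV_sum by auto
      also have "prob \<dots> = prob (\<Inter>i. A (Inl i)) * prob (\<Inter>j. A (Inr j))"
        unfolding l r
        by (rule indep_setD[OF XY[unfolded indep_rvs_def, THEN conjunct2, THEN conjunct2]])
          (auto intro!: exI sets_PiM_I_finite B(1) C)
      also have "prob (\<Inter>i. A (Inl i)) = (\<Prod>i\<in>UNIV. prob (A (Inl i)))"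
        using X unfolding indep_vars_def2 Al
        by (intro indep_setsD) (auto intro!: exI B(1))
      also have "prob (\<Inter>j. A (Inr j)) = (\<Prod>j\<in>UNIV. prob (A (Inr j)))"
        using Y unfolding indep_vars_def2 Ar
        by (intro indep_setsD) (auto intro!: exI C)
      also have "(\<Prod>i\<in>UNIV. prob (A (Inl i))) * (\<Prod>j\<in>UNIV. prob (A (Inr j))) = (\<Prod>s\<in>UNIV. prob (A s))"
        using prod.Plus[of UNIV UNIV "\<lambda>s. prob (A s)"] by simp
      finally show "prob (\<Inter>s\<in>UNIV. A s) = (\<Prod>s\<in>UNIV. prob (A s))" .
    qed
  qed auto
  then show ?thesis unfolding indep_vars_def2 using rV by blast
qed

text \<open>Restricting the family to \<open>A\<close> and \<open>B\<close> forces \<open>f\<close>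
  and \<open>g\<close> to read disjoint sets of coordinates.\<close>

lemma indep_var_blocks:
  assumes ind: "indep_vars (\<lambda>_. N) V UNIV" and AB: "A \<inter> B = {}"
    and f: "f \<in> measurable (Pi\<^sub>M A (\<lambda>_. N)) K" and g: "g \<in> measurable (Pi\<^sub>M B (\<lambda>_. N)) L"
    and X: "\<And>\<omega>. X \<omega> = f (restrict (\<lambda>i. V i \<omega>) A)" and Y: "\<And>\<omega>. Y \<omega> = g (restrict (\<lambda>i. V i \<omega>) B)"
  shows "indep_var K X L Y"
  using indep_var_compose[OF indep_var_restrict[OF ind AB] f g] by (simp add: o_def X[symmetric] Y[symmetric])

end

section \<open>Pilot observations and the effective SINR\<close>

lemma outer_matrix_vector: "outer x p *v v = cdot p v *s x"
  by (simp add: vec_eq_iff outer_def cdot_def matrix_vector_mult_def sum_distrib_left sum_distrib_right ac_simps)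

lemma sum_matrix_vector:
  fixes A :: "'i \<Rightarrow> complex ^ 'n ^ 'm"
  shows "(\<Sum>i\<in>I. A i) *v v = (\<Sum>i\<in>I. A i *v v)"
  by (induction I rule: infinite_finite_induct) (auto simp: matrix_vector_mult_add_rdistrib)

lemma scaleR_matrix_vector:
  fixes A :: "complex ^ 'n ^ 'm"
  shows "(c *\<^sub>R A) *v v = c *\<^sub>R (A *v v)"
  by (simp add: vec_eq_iff matrix_vector_mult_def scaleR_sum_right)

lemma trace_scaleR: "trace (c *\<^sub>R (A :: complex ^ 'm ^ 'm)) = of_real c * trace A"
  by (simp add: trace_def sum_distrib_left scaleR_conv_of_real[where 'a = complex])

text \<open>Correlation with the pilot keeps user index \<open>i\<close> in every cell, which is the
  source of pilot contamination.\<close>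

lemma pilot_observation_orthogonal:
  assumes orth: "\<And>l' i'. cdot (\<phi> l' i') (\<phi> l i) = of_bool (i' = i)"
  shows "pilot_observation \<rho> \<phi> h Nz l i n \<omega> =
    (\<Sum>l'\<in>UNIV. h l' i l n \<omega>) + (1 / sqrt \<rho>) *\<^sub>R (Nz l n \<omega> *v \<phi> l i)"
proof -
  have "(\<Sum>i'\<in>UNIV. outer (h l' i' l n \<omega>) (\<phi> l' i') *v \<phi> l i) = h l' i l n \<omega>" for l'
    by (simp add: outer_matrix_vector orth vec_eq_iff of_bool_def if_distrib[of "\<lambda>x. x * _"] cong: if_cong)
  then show ?thesis
    by (simp add: pilot_observation_def matrix_vector_mult_add_rdistrib sum_matrix_vector scaleR_matrix_vector)
qed

lemma circ_complex_gaussian_centered: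
  "prob_space M \<Longrightarrow> circ_complex_gaussian M Z R \<Longrightarrow> centered_gaussian M Z"
  by (simp add: circ_complex_gaussian_def centered_gaussian_def centered_gaussian_axioms_def)

text \<open>The fractions are compared as complex numbers, where traces take their values;
  \<open>den\<close> in the proof identifies the denominator on the right with a real
  number.\<close>

theorem theorem1:
  fixes P :: "'w measure"
    and \<rho> \<sigma>2 :: real
    and R :: "'l::finite \<Rightarrow> 'k::finite \<Rightarrow> 'l \<Rightarrow> 'n::finite \<Rightarrow> complex ^ 'm::finite ^ 'm"
    and h :: "'l \<Rightarrow> 'k \<Rightarrow> 'l \<Rightarrow> 'n \<Rightarrow> 'w \<Rightarrow> complex ^ 'm"
    and Nz :: "'l \<Rightarrow> 'n \<Rightarrow> 'w \<Rightarrow> complex ^ 'k ^ 'm"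
    and \<phi> :: "'l \<Rightarrow> 'k \<Rightarrow> complex ^ 'k"
    and y a :: "'l \<Rightarrow> 'k \<Rightarrow> 'n \<Rightarrow> 'w \<Rightarrow> complex ^ 'm"
    and Q W :: "'l \<Rightarrow> 'k \<Rightarrow> 'n \<Rightarrow> complex ^ 'm ^ 'm"
    and \<nu> :: "'l \<Rightarrow> 'k \<Rightarrow> 'n \<Rightarrow> real"
    and j :: 'l and k :: 'k
  assumes prob: "prob_space P"
    and rho_pos: "\<rho> > 0"
    and noise_var_pos: "\<sigma>2 > 0"
    \<comment> \<open>channels\<close>
    and R_psd: "\<And>j k l n. hermitian_psd (R j k l n)"
    and h_gaussian: "\<And>j k l n. circ_complex_gaussian P (h j k l n) (R j k l n)"
    and h_indep: "prob_space.indep_vars P (\<lambda>_. borel) (\<lambda>(j, k, l, n). h j k l n) UNIV"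
    \<comment> \<open>pilots\<close>
    and pilot_norm: "\<And>j k. norm (\<phi> j k) = 1"
    and pilot_orth: "\<And>j i k. i \<noteq> k \<Longrightarrow> cdot (\<phi> j i) (\<phi> j k) = 0"
    and pilot_reuse: "\<And>l j k. \<phi> l k = \<phi> j k"
    \<comment> \<open>noise matrices\<close>
    and noise_entry: "\<And>j n m i.
      circ_complex_gaussian P (\<lambda>\<omega>. vec (Nz j n \<omega> $ m $ i) :: complex ^ 1) (mat 1)"
    and noise_entries_indep: "\<And>j n.
      prob_space.indep_vars P (\<lambda>_. borel) (\<lambda>(m, i) \<omega>. Nz j n \<omega> $ m $ i) UNIV"
    and noise_indep: "prob_space.indep_vars P (\<lambda>_. borel) (\<lambda>(j, n). Nz j n) UNIV"
    and noise_channel_indep: "indep_rvs P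
      (\<Pi>\<^sub>M _\<in>UNIV. borel) (\<lambda>\<omega>. \<lambda>(j, k, l, n). h j k l n \<omega>)
      (\<Pi>\<^sub>M _\<in>UNIV. borel) (\<lambda>\<omega>. \<lambda>(j, n). Nz j n \<omega>)"
    \<comment> \<open>pilot observations, their covariances, and the MMSE-based precoders\<close>
    and y_def: "\<And>j k n. y j k n = pilot_observation \<rho> \<phi> h Nz j k n"
    and Q_def: "\<And>j k n. Q j k n = (\<integral>\<omega>. outer (y j k n \<omega>) (y j k n \<omega>) \<partial>P)"
    and W_def: "\<And>j k n. W j k n = R j k j n ** matrix_inv (Q j k n)"
    and a_mrt: "\<And>j k n \<omega>. a j k n \<omega> = W j k n *v y j k n \<omega>"
    and nu_nonneg: "\<And>l i n. \<nu> l i n \<ge> 0"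
  shows "of_real (downlink_sinr P \<sigma>2 \<nu> h a j k) =
    of_real ((cmod (\<Sum>n\<in>UNIV. trace (\<nu> j k n *\<^sub>R (W j k n ** R j k j n))))\<^sup>2) /
    ((\<Sum>l\<in>UNIV. \<Sum>i\<in>UNIV. \<Sum>n\<in>UNIV.
        trace ((\<nu> l i n)\<^sup>2 *\<^sub>R (W l i n ** Q l i n ** conj_transpose (W l i n) ** R j k l n)))
     + of_real (\<Sum>l\<in>UNIV - {j}. (cmod (\<Sum>n\<in>UNIV. trace (\<nu> l k n *\<^sub>R (W l k n ** R j k l n))))\<^sup>2)
     + of_real \<sigma>2)"
proof -
  interpret prob_space P by (rule prob)
  have cdot_pilot: "cdot (\<phi> l i) (\<phi> l' i') = of_bool (i = i')" for l l' i i'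
  proof (cases "i = i'")
    case True
    have "cdot (\<phi> l i) (\<phi> l i) = (\<Sum>b\<in>UNIV. complex_of_real ((norm (\<phi> l i $ b))\<^sup>2))"
      by (simp add: cdot_def complex_norm_square mult.commute del: of_real_power)
    also have "\<dots> = complex_of_real ((norm (\<phi> l i))\<^sup>2)"
      by (simp add: norm_vec_def L2_set_def sum_nonneg)
    finally show ?thesis using True pilot_norm pilot_reuse[of l' i l] by simp
  next
    case False
    then show ?thesis using pilot_orth[of i i' l] pilot_reuse[of l' i' l] by simp
  qed
  define c where "c = 1 / sqrt \<rho>"
  have y_eq: "y l i n \<omega> = (\<Sum>l'\<in>UNIV. h l' i l n \<omega>) + c *\<^sub>R (Nz l n \<omega> *v \<phi> l i)" for l i n \<omega>
    unfolding y_def c_def by (rule pilot_observation_orthogonal) (simp add: cdot_pilot)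

  have h_sq: "sq_integrable P (\<lambda>\<omega>. h l' i l n \<omega> $ b)"
    and h_mean: "expectation (\<lambda>\<omega>. h l' i l n \<omega> $ b) = 0" for l' i l n b
  proof -
    interpret centered_gaussian P "h l' i l n"
      by (rule circ_complex_gaussian_centered[OF prob h_gaussian])
    show "sq_integrable P (\<lambda>\<omega>. h l' i l n \<omega> $ b)"
      by (rule complex_linear_sq_integrable[OF complex_linear_nth])
    show "expectation (\<lambda>\<omega>. h l' i l n \<omega> $ b) = 0" by (rule expectation_nth)
  qed
  have N_sq: "sq_integrable P (\<lambda>\<omega>. Nz l n \<omega> $ b $ e)"
    and N_mean: "expectation (\<lambda>\<omega>. Nz l n \<omega> $ b $ e) = 0" for l n b e
  proof -
    interpret centered_gaussian P "\<lambda>\<omega>. vec (Nz l n \<omega> $ b $ e) :: complex ^ 1"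
      by (rule circ_complex_gaussian_centered[OF prob noise_entry])
    show "sq_integrable P (\<lambda>\<omega>. Nz l n \<omega> $ b $ e)"
      using complex_linear_sq_integrable[OF complex_linear_nth[of 1]] by simp
    show "expectation (\<lambda>\<omega>. Nz l n \<omega> $ b $ e) = 0"
      using expectation_nth[of 1] by simp
  qed
  have w_sq: "sq_integrable P (\<lambda>\<omega>. (Nz l n \<omega> *v v) $ b)" for l n v b
    unfolding matrix_vector_mult_def
    using sq_integrable_sum[of UNIV P "\<lambda>e \<omega>. v $ e * Nz l n \<omega> $ b $ e"]
    by (simp add: sq_integrable_cmult N_sq mult.commute)
  have w_mean: "expectation (\<lambda>\<omega>. (Nz l n \<omega> *v v) $ b) = 0" for l n v b
    unfolding matrix_vector_mult_def
    by (simp add: N_mean sq_integrable_integrable[OF N_sq])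

  \<comment> \<open>Multiplied by a fixed pilot \<open>v\<close>, the noise takes values in the same
    space as the channels, so all sources of randomness form one independent family over a sum
    type.\<close>
  have joint: "indep_vars (\<lambda>_. borel) (case_sum (\<lambda>(j, k, l, n). h j k l n)
      (\<lambda>q \<omega>. (case q of (l, n) \<Rightarrow> Nz l n) \<omega> *v v)) UNIV" for v
  proof (rule indep_vars_Plus[OF h_indep noise_indep])
    have "(\<lambda>\<omega> q. (case q of (j, k, l, n) \<Rightarrow> h j k l n) \<omega>) = (\<lambda>\<omega>. \<lambda>(j, k, l, n). h j k l n \<omega>)"
      "(\<lambda>\<omega> q. (case q of (l, n) \<Rightarrow> Nz l n) \<omega>) = (\<lambda>\<omega>. \<lambda>(l, n). Nz l n \<omega>)"
      by (auto simp: fun_eq_iff)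
    then show "indep_rvs P (\<Pi>\<^sub>M _\<in>UNIV. borel) (\<lambda>\<omega> q. (case q of (j, k, l, n) \<Rightarrow> h j k l n) \<omega>)
      (\<Pi>\<^sub>M _\<in>UNIV. borel) (\<lambda>\<omega> q. (case q of (l, n) \<Rightarrow> Nz l n) \<omega>)"
      using noise_channel_indep by simp
    show "(\<lambda>A. A *v v) \<in> borel_measurable borel"
      unfolding matrix_vector_mult_def
      by (intro borel_measurable_continuous_onI continuous_intros)
  qed

  \<comment> \<open>The desired channel occurs in the observation exactly when \<open>i = k\<close>,
    as the summand of cell \<open>j\<close>. The conditional removes that summand from
    \<open>z\<close>, and in the other case keeps all of them.\<close>
  have link: "gaussian_link P (h j k l n) (R j k l n)
      (\<lambda>\<omega>. (\<Sum>l'\<in>UNIV. if l' = j \<and> i = k then 0 else h l' i l n \<omega>) + c *\<^sub>R (Nz l n \<omega> *v \<phi> l i))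
      (y l i n) (of_bool (i = k))" (is "gaussian_link P _ _ ?z _ _") for l i n
  proof -
    interpret centered_gaussian P "h j k l n"
      by (rule circ_complex_gaussian_centered[OF prob h_gaussian])
    let ?s = "Inl (j, k, l, n) :: ('l \<times> 'k \<times> 'l \<times> 'n) + ('l \<times> 'n)"
    have sq: "sq_integrable P (\<lambda>\<omega>. (if p then 0 else h l' i l n \<omega>) $ b)" for p l' b
      by (cases p) (simp_all add: h_sq)
    have mean: "expectation (\<lambda>\<omega>. (if p then 0 else h l' i l n \<omega>) $ b) = 0" for p l' b
      by (cases p) (simp_all add: h_mean)
    have z_nth: "?z \<omega> $ b = (\<Sum>l'\<in>UNIV. (if l' = j \<and> i = k then 0 else h l' i l n \<omega>) $ b)
        + of_real c * (Nz l n \<omega> *v \<phi> l i) $ b" for \<omega> b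
      by (simp add: scaleR_conv_of_real[where 'a = complex])
    show ?thesis
    proof
      show "circ_complex_gaussian P (h j k l n) (R j k l n)" by (rule h_gaussian)
      show "sq_integrable P (\<lambda>\<omega>. ?z \<omega> $ b)" for b
        unfolding z_nth by (intro sq_integrable_add sq_integrable_sum sq_integrable_cmult sq w_sq)
      show "expectation (\<lambda>\<omega>. ?z \<omega> $ b) = 0" for b
        unfolding z_nth using sq_integrable_integrable[OF sq] sq_integrable_integrable[OF w_sq]
        by (simp only: Bochner_Integration.integral_add Bochner_Integration.integrable_sum
            Bochner_Integration.integral_sum integrable_mult_right integral_mult_right_zero mean w_mean) simp
      \<comment> \<open>The channel is the single coordinate \<open>?s\<close> of the joint family,
        and \<open>z\<close> reads only the remaining ones.\<close>
      show "indep_var borel (h j k l n) borel ?z"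
      proof (rule indep_var_blocks[OF joint[of "\<phi> l i"], of "{?s}" "- {?s}" "\<lambda>g. g ?s" _
            "\<lambda>g. (\<Sum>l'\<in>UNIV. if l' = j \<and> i = k then 0 else g (Inl (l', i, l, n))) + c *\<^sub>R g (Inr (l, n))"])
        show "(\<lambda>g. g ?s) \<in> measurable (\<Pi>\<^sub>M _\<in>{?s}. borel) borel"
          by (rule measurable_component_singleton) simp
        have "(\<lambda>g. if l' = j \<and> i = k then 0 else g (Inl (l', i, l, n)))
            \<in> borel_measurable (\<Pi>\<^sub>M _\<in>- {?s}. borel :: (complex ^ 'm) measure)" for l'
          by (cases "l' = j \<and> i = k") (auto intro!: measurable_component_singleton)
        moreover have "(\<lambda>g. g (Inr (l, n))) \<in> borel_measurable (\<Pi>\<^sub>M _\<in>- {?s}. borel :: (complex ^ 'm) measure)"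
          by (rule measurable_component_singleton) simp
        ultimately show "(\<lambda>g. (\<Sum>l'\<in>UNIV. if l' = j \<and> i = k then 0 else g (Inl (l', i, l, n))) + c *\<^sub>R g (Inr (l, n)))
            \<in> borel_measurable (\<Pi>\<^sub>M _\<in>- {?s}. borel :: (complex ^ 'm) measure)"
          by (intro borel_measurable_add borel_measurable_sum borel_measurable_scaleR borel_measurable_const)
      qed (auto intro!: sum.cong)
      have "(\<Sum>l'\<in>UNIV. h l' i l n \<omega>) = of_bool (i = k) *s h j k l n \<omega> +
          (\<Sum>l'\<in>UNIV. if l' = j \<and> i = k then 0 else h l' i l n \<omega>)" for \<omega>
        by (cases "i = k") (auto simp: sum.remove[of UNIV j] intro!: sum.cong)
      then show "y l i n \<omega> $ b = of_bool (i = k) * h j k l n \<omega> $ b + ?z \<omega> $ b" for b \<omega>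
        by (simp add: y_eq)
    qed
  qed

  have links_indep: "indep_var borel (\<lambda>\<omega>. cdot (h j k l n \<omega>) (a l i n \<omega>))
      borel (\<lambda>\<omega>. cdot (h j k l n' \<omega>) (a l i n' \<omega>))" if "n \<noteq> n'" for l i n n'
  proof -
    \<comment> \<open>The block of sub-array \<open>n\<close> in cell \<open>l\<close>: all channels
      arriving there and its noise. Blocks of different sub-arrays are disjoint, and
      \<open>G n\<close> computes the link variable from its block.\<close>
    define B :: "'n \<Rightarrow> (('l \<times> 'k \<times> 'l \<times> 'n) + ('l \<times> 'n)) set"
      where "B n = range (\<lambda>(l', i'). Inl (l', i', l, n)) \<union> {Inr (l, n)}" for n
    define G where "G n g = cdot (g (Inl (j, k, l, n)))
        (W l i n *v ((\<Sum>l'\<in>UNIV. g (Inl (l', i, l, n))) + c *\<^sub>R g (Inr (l, n))))"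
      for n and g :: "('l \<times> 'k \<times> 'l \<times> 'n) + ('l \<times> 'n) \<Rightarrow> complex ^ 'm"
    have inB: "Inl (l', i', l, n) \<in> B n" "Inr (l, n) \<in> B n" for l' i' n
      by (auto simp: B_def)
    have "G n \<in> borel_measurable (\<Pi>\<^sub>M _\<in>B n. borel)" for n
    proof -
      have comp: "(\<lambda>g. (g s) $ b) \<in> borel_measurable (\<Pi>\<^sub>M _\<in>B n. borel :: (complex ^ 'm) measure)"
        if "s \<in> B n" for s b
        using measurable_compose[OF measurable_component_singleton[OF that] measurable_vec_nth] .
      show ?thesis
        unfolding G_def cdot_matrix_vector sum_component vector_add_component vector_scaleR_component
        by (intro borel_measurable_sum borel_measurable_times borel_measurable_add
            borel_measurable_scaleR borel_measurable_const comp inB measurable_compose[OF comp measurable_cnj])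
    qed
    moreover have "B n \<inter> B n' = {}"
      using that by (auto simp: B_def)
    ultimately show ?thesis
      by (intro indep_var_blocks[OF joint[of "\<phi> l i"], of "B n" "B n'" "G n" _ "G n'"])
        (simp_all add: inB G_def a_mrt y_eq)
  qed

  let ?m = "\<lambda>l i n. of_bool (i = k) * trace (W l i n ** R j k l n)"
  let ?v = "\<lambda>l i n. trace (W l i n ** Q l i n ** conj_transpose (W l i n) ** R j k l n)"
  have mean: "expectation (\<lambda>\<omega>. cdot (h j k l n \<omega>) (a l i n \<omega>)) = ?m l i n" for l i n
    unfolding a_mrt by (rule gaussian_link.link_mean[OF link])
  have power: "complex_of_real (expectation (\<lambda>\<omega>. (cmod (\<Sum>n\<in>UNIV.
      of_real (\<nu> l i n) * cdot (h j k l n \<omega>) (a l i n \<omega>)))\<^sup>2)) =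
      of_real ((cmod (\<Sum>n\<in>UNIV. of_real (\<nu> l i n) * ?m l i n))\<^sup>2)
      + (\<Sum>n\<in>UNIV. of_real ((\<nu> l i n)\<^sup>2) * ?v l i n)" for l i
  proof (rule sum_second_moment[OF _ links_indep _ mean])
    show "sq_integrable P (\<lambda>\<omega>. cdot (h j k l n \<omega>) (a l i n \<omega>))" for n
      unfolding a_mrt by (rule gaussian_link.link_sq_integrable[OF link])
    show "expectation (\<lambda>\<omega>. cdot (h j k l n \<omega>) (a l i n \<omega>) * cnj (cdot (h j k l n \<omega>) (a l i n \<omega>))) =
        ?m l i n * cnj (?m l i n) + ?v l i n" for n
      unfolding a_mrt Q_def by (rule gaussian_link.link_second_moment[OF link])
  qed
  define S where "S l = (cmod (\<Sum>n\<in>UNIV. of_real (\<nu> l k n) * trace (W l k n ** R j k l n)))\<^sup>2" for l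
  \<comment> \<open>The means vanish for \<open>i \<noteq> k\<close>, so each cell contributes only
    its user with the pilot of \<open>(j, k)\<close>.\<close>
  have S: "(\<Sum>i\<in>UNIV. (cmod (\<Sum>n\<in>UNIV. of_real (\<nu> l i n) * ?m l i n))\<^sup>2) = S l" for l
    by (subst sum.remove[of UNIV k]) (auto simp: S_def intro!: sum.neutral)
  have "complex_of_real ((\<Sum>l\<in>UNIV. \<Sum>i\<in>UNIV. expectation (\<lambda>\<omega>. (cmod (\<Sum>n\<in>UNIV.
      of_real (\<nu> l i n) * cdot (h j k l n \<omega>) (a l i n \<omega>)))\<^sup>2)) - S j + \<sigma>2) =
      of_real (\<Sum>l\<in>UNIV. S l) + (\<Sum>l\<in>UNIV. \<Sum>i\<in>UNIV. \<Sum>n\<in>UNIV. of_real ((\<nu> l i n)\<^sup>2) * ?v l i n)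
      - of_real (S j) + of_real \<sigma>2"
    by (simp only: of_real_add of_real_diff of_real_sum power sum.distrib S[symmetric])
  \<comment> \<open>The summand of the own cell is the signal power that the SINR subtracts; the
    others remain as coherent interference.\<close>
  also have "(\<Sum>l\<in>UNIV. S l) = S j + (\<Sum>l\<in>UNIV - {j}. S l)"
    by (simp add: sum.remove)
  finally have den: "complex_of_real ((\<Sum>l\<in>UNIV. \<Sum>i\<in>UNIV. expectation (\<lambda>\<omega>. (cmod (\<Sum>n\<in>UNIV.
      of_real (\<nu> l i n) * cdot (h j k l n \<omega>) (a l i n \<omega>)))\<^sup>2)) - S j + \<sigma>2) =
      (\<Sum>l\<in>UNIV. \<Sum>i\<in>UNIV. \<Sum>n\<in>UNIV. of_real ((\<nu> l i n)\<^sup>2) * ?v l i n)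
      + of_real (\<Sum>l\<in>UNIV - {j}. S l) + of_real \<sigma>2"
    by simp
  have "(cmod (\<Sum>n\<in>UNIV. of_real (\<nu> j k n) * expectation (\<lambda>\<omega>. cdot (h j k j n \<omega>) (a j k n \<omega>))))\<^sup>2 = S j"
    by (simp add: mean S_def)
  then have "complex_of_real (downlink_sinr P \<sigma>2 \<nu> h a j k) = of_real (S j) /
      ((\<Sum>l\<in>UNIV. \<Sum>i\<in>UNIV. \<Sum>n\<in>UNIV. of_real ((\<nu> l i n)\<^sup>2) * ?v l i n)
      + of_real (\<Sum>l\<in>UNIV - {j}. S l) + of_real \<sigma>2)"
    by (simp only: downlink_sinr_def of_real_divide den)
  then show ?thesis
    by (simp only: trace_scaleR S_def)
qed

end
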